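(* Let $\mathcal{P}$ be a hereditary property of digraphs, respectively orgraphs, respectively tournaments, with $\mathcal{P}_n\neq\emptyset$ for every $n$, and let $k=4$, respectively $k=3$, respectively $k=2$. Identify $\mathcal{P}$ with the corresponding property of $\Sigma$-colourings of complete graphs. Then: (a) For every $\varepsilon>0$ and $m\in\mathbb{N}$ there exists $n_0$ such that for any $n\ge n_0$ there is a collection $\mathcal{T}$ of templates for $K_n$ such that: (i) $\mathcal{P}_n\subseteq\bigcup_{t\in\mathcal{T}}\langle t\rangle$; (ii) every $t\in\mathcal{T}$ has $\mathrm{Ent}(t)\le(\pi(\mathcal{P})+\varepsilon)\binom n2$; (iii) for every realisation $c$ of a template in $\mathcal{T}$ there are at most $\varepsilon\binom nm$ subsets $A\subseteq[n]$ of size $m$ with $c_{|A}\notin\mathcal{P}_m$; (iv) $|\mathcal{T}|\le k^{\varepsilon\binom n2}$. (b) If $\mathcal{S}$ is a strong stability family for $\mathcal{P}$, then for all $\varepsilon>0$ there exists $n_0\in\mathbb{N}$ such that for all $n\ge n_0$ there are at most $\varepsilon|\mathcal{P}_n|$ elements $c\in\mathcal{P}_n$ with $\rho(c,\langle\mathcal{S}\rangle)>\varepsilon\binom n2$.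
   Context: A digraph on $[n]$ is a set of ordered pairs of distinct elements of $[n]$ (both $\vec{ij}$ and $\vec{ji}$ may be present). An orgraph (oriented graph) is a digraph in which, for each pair $\{i,j\}$, at most one of $\vec{ij},\vec{ji}$ is present; a tournament is one in which exactly one is present. A hereditary property of digraphs/orgraphs/tournaments is a sequence $\mathcal{P}=(\mathcal{P}_n)_n$, $\mathcal{P}_n$ a set of such objects on vertex set $[n]$, closed under isomorphism and under taking induced subgraphs. Encoding: a digraph $D$ on $[n]$ is encoded as the colouring $c$ of $E(K_n)$ with, for $i<j$: $c(ij)=1$ if neither $\vec{ij}$ nor $\vec{ji}$ is in $D$; $c(ij)=2$ if only $\vec{ij}$ is; $c(ij)=3$ if only $\vec{ji}$ is; $c(ij)=4$ if both are. The colour set is $\Sigma=\{1,2,3,4\}$ for digraphs, $\Sigma=\{1,2,3\}$ for orgraphs, $\Sigma=\{2,3\}$ for tournaments, so $|\Sigma|=k$. A $\Sigma$-colouring of $K_n$ is a map $c:E(K_n)\to\Sigma$. For $A=\{a_1<\dots<a_m\}\subseteq[n]$, $c_{|A}$ is the colouring of $K_m$ with $c_{|A}(ij)=c(a_ia_j)$. A template for $K_n$ is a function $t$ assigning to each edge a nonempty set $t(e)\subseteq\Sigma$; $t_{|A}(ij)=t(a_ia_j)$; $\langle t\rangle$ is the set of realisations of $t$ (colourings with $c(e)\in t(e)$ for all $e$); $\mathrm{Ent}(t)=\sum_e\log_k|t(e)|$. $\mathrm{ex}(n,\mathcal{P})=\max\{\mathrm{Ent}(t):\langle t\rangle\subseteq\mathcal{P}_n\}$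 and $\pi(\mathcal{P})=\lim_{n\to\infty}\mathrm{ex}(n,\mathcal{P})/\binom n2$ (the limit exists). A template sequence is $(t_n)_n$ with $t_n$ a template for $K_n$. $\rho(s,t)$ is the number of edges on which two templates (or two colourings) of $K_n$ differ. For a family $\mathcal{S}$ of template sequences and a colouring $c$ of $K_n$, $\rho(c,\langle\mathcal{S}\rangle)=\min\{\rho(c,c'):c'\in\langle t_n\rangle,\ (t_j)_j\in\mathcal{S}\}$. $\mathcal{S}$ is a strong stability family for $\mathcal{P}$ if for all $\varepsilon>0$ there exist $\delta>0$ and $m,n_0\in\mathbb{N}$ such that for all $n\ge n_0$ every template $t$ for $K_n$ with $\mathrm{Ent}(t)\ge(\pi(\mathcal{P})-\delta)\binom n2$ and with at most $\delta\binom nm$ pairs $(A,c)$, $A$ an $m$-subset of $[n]$, $c\in\langle t_{|A}\rangle$, $c\notin\mathcal{P}_m$, lies within edit distance at most $\varepsilon\binom n2$ of the $n$-th term of some sequence in $\mathcal{S}$. *)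

theory Defs
  imports Complex_Main "HOL-Library.FuncSet" "HOL-Library.Ramsey"
begin

section \<open>Hereditary properties of digraphs, orgraphs and tournaments\<close>

datatype digraph_kind = Digraphs | Orgraphs | Tournaments

definition digraph_on :: "nat \<Rightarrow> nat rel \<Rightarrow> bool" where
  "digraph_on n D \<longleftrightarrow> D \<subseteq> {1..n} \<times> {1..n} \<and> irrefl D"

definition orgraph_on :: "nat \<Rightarrow> nat rel \<Rightarrow> bool" where
  "orgraph_on n D \<longleftrightarrow> digraph_on n D \<and> asym D"

definition tournament_on :: "nat \<Rightarrow> nat rel \<Rightarrow> bool" where
  "tournament_on n D \<longleftrightarrow> orgraph_on n D \<and> total_on {1..n} D"

fun of_kind :: "digraph_kind \<Rightarrow> nat \<Rightarrow> nat rel \<Rightarrow> bool" where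
  "of_kind Digraphs = digraph_on"
| "of_kind Orgraphs = orgraph_on"
| "of_kind Tournaments = tournament_on"

definition digraph_iso :: "nat \<Rightarrow> nat rel \<Rightarrow> nat rel \<Rightarrow> bool" where
  "digraph_iso n D D' \<longleftrightarrow>
    (\<exists>f. bij_betw f {1..n} {1..n} \<and>
         (\<forall>i\<in>{1..n}. \<forall>j\<in>{1..n}. (i, j) \<in> D \<longleftrightarrow> (f i, f j) \<in> D'))"

text \<open>If $A = \{a_1 < \dots < a_m\}$, then \<open>elt A i\<close> is $a_i$ for $1 \le i \le m$.\<close>

definition elt :: "nat set \<Rightarrow> nat \<Rightarrow> nat" where
  "elt A i = sorted_list_of_set A ! (i - 1)"

text \<open>The members of a property live on vertex sets $[m]$, so the subgraph induced by $A$ is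
  transported to $[|A|]$ along the increasing enumeration of $A$. Since hereditary properties
  are also closed under isomorphism, the choice of enumeration is immaterial.\<close>

definition induced_subgraph :: "nat rel \<Rightarrow> nat set \<Rightarrow> nat rel" where
  "induced_subgraph D A =
    {(i, j). i \<in> {1..card A} \<and> j \<in> {1..card A} \<and> (elt A i, elt A j) \<in> D}"

definition hereditary :: "digraph_kind \<Rightarrow> (nat \<Rightarrow> nat rel set) \<Rightarrow> bool" where
  "hereditary \<kappa> P \<longleftrightarrow>
    (\<forall>n. \<forall>D\<in>P n. of_kind \<kappa> n D) \<and>
    (\<forall>n. \<forall>D\<in>P n. \<forall>D'. digraph_on n D' \<and> digraph_iso n D D' \<longrightarrow> D' \<in> P n) \<and>
    (\<forall>n. \<forall>D\<in>P n. \<forall>A. A \<subseteq> {1..n} \<longrightarrow> induced_subgraph D A \<in> P (card A))"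


section \<open>Colourings, templates and entropy\<close>

text \<open>Colourings and templates of $K_n$ are functions on \<open>edges n\<close>, extended by \<^const>\<open>undefined\<close>
  elsewhere, so that equality of functions is equality on $E(K_n)$.\<close>

type_synonym colouring = "nat set \<Rightarrow> nat"
type_synonym template = "nat set \<Rightarrow> nat set"

definition edges :: "nat \<Rightarrow> nat set set" where
  "edges n = nsets {1..n} 2"

definition templates :: "nat set \<Rightarrow> nat \<Rightarrow> template set" where
  "templates \<Sigma> n = edges n \<rightarrow>\<^sub>E (Pow \<Sigma> - {{}})"

text \<open>Serves both for $c_{|A}$ with $c$ a colouring and for $t_{|A}$ with $t$ a template.\<close>

definition restr :: "(nat set \<Rightarrow> 'a) \<Rightarrow> nat set \<Rightarrow> nat set \<Rightarrow> 'a" where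
  "restr c A = restrict (\<lambda>e. c (elt A ` e)) (edges (card A))"

definition realisations :: "nat \<Rightarrow> template \<Rightarrow> colouring set" where
  "realisations n t = Pi\<^sub>E (edges n) t"

definition Ent :: "nat set \<Rightarrow> nat \<Rightarrow> template \<Rightarrow> real" where
  "Ent \<Sigma> n t = (\<Sum>e\<in>edges n. log (real (card \<Sigma>)) (real (card (t e))))"

definition extremal :: "nat set \<Rightarrow> (nat \<Rightarrow> colouring set) \<Rightarrow> nat \<Rightarrow> real" where
  "extremal \<Sigma> Q n = Max {Ent \<Sigma> n t | t. t \<in> templates \<Sigma> n \<and> realisations n t \<subseteq> Q n}"

definition entropy_density :: "nat set \<Rightarrow> (nat \<Rightarrow> colouring set) \<Rightarrow> real" where
  "entropy_density \<Sigma> Q = lim (\<lambda>n. extremal \<Sigma> Q n / real (n choose 2))"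

definition edit_dist :: "nat \<Rightarrow> (nat set \<Rightarrow> 'a) \<Rightarrow> (nat set \<Rightarrow> 'a) \<Rightarrow> nat" where
  "edit_dist n s t = card {e \<in> edges n. s e \<noteq> t e}"

definition template_seqs :: "nat set \<Rightarrow> (nat \<Rightarrow> template) set" where
  "template_seqs \<Sigma> = {t. \<forall>n. t n \<in> templates \<Sigma> n}"

text \<open>Only meaningful for nonempty families.\<close>

definition dist_family :: "nat \<Rightarrow> colouring \<Rightarrow> (nat \<Rightarrow> template) set \<Rightarrow> nat" where
  "dist_family n c S = Min {edit_dist n c c' | c' t. t \<in> S \<and> c' \<in> realisations n (t n)}"

definition strong_stability_family ::
    "nat set \<Rightarrow> (nat \<Rightarrow> colouring set) \<Rightarrow> (nat \<Rightarrow> template) set \<Rightarrow> bool" where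
  "strong_stability_family \<Sigma> Q S \<longleftrightarrow>
    S \<subseteq> template_seqs \<Sigma> \<and>
    (\<forall>\<epsilon>::real. \<epsilon> > 0 \<longrightarrow>
      (\<exists>\<delta>::real. \<exists>m n\<^sub>0. \<delta> > 0 \<and>
        (\<forall>n\<ge>n\<^sub>0. \<forall>t\<in>templates \<Sigma> n.
          Ent \<Sigma> n t \<ge> (entropy_density \<Sigma> Q - \<delta>) * real (n choose 2) \<and>
          real (card {(A, c). A \<in> nsets {1..n} m \<and> c \<in> realisations m (restr t A) \<and> c \<notin> Q m})
            \<le> \<delta> * real (n choose m)
          \<longrightarrow> (\<exists>s\<in>S. real (edit_dist n t (s n)) \<le> \<epsilon> * real (n choose 2)))))"


section \<open>Encoding digraphs as colourings\<close>

fun palette :: "digraph_kind \<Rightarrow> nat set" where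
  "palette Digraphs = {1, 2, 3, 4}"
| "palette Orgraphs = {1, 2, 3}"
| "palette Tournaments = {2, 3}"

definition pair_colour :: "nat rel \<Rightarrow> nat \<Rightarrow> nat \<Rightarrow> nat" where
  "pair_colour D i j =
    (if (i, j) \<notin> D \<and> (j, i) \<notin> D then 1
     else if (i, j) \<in> D \<and> (j, i) \<notin> D then 2
     else if (i, j) \<notin> D \<and> (j, i) \<in> D then 3
     else 4)"

definition encode :: "nat \<Rightarrow> nat rel \<Rightarrow> colouring" where
  "encode n D = restrict (\<lambda>e. pair_colour D (Min e) (Max e)) (edges n)"

definition colouring_property :: "(nat \<Rightarrow> nat rel set) \<Rightarrow> nat \<Rightarrow> colouring set" where
  "colouring_property P n = encode n ` P n"

end

theory Submission
  imports Defs
begin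

text \<open>Instead of the general hypergraph container theorem, the proof uses a direct argument that suffices
  because only \<open>k powr o(n\<^sup>2)\<close> containers are needed. Suppose that a template \<open>t\<close> has many \<open>N\<close>-sets on
  which it realises a colouring outside the property. By pigeonhole many increasing maps
  \<open>[N] \<rightarrow> [n]\<close> embed one forbidden colouring \<open>g\<close> into \<open>t\<close>. Fix \<open>c \<in> Q n\<close> realising \<open>t\<close> and demand,
  one edge \<open>e\<close> of \<open>K\<^sub>N\<close> after the other, that the image of \<open>e\<close> even has colour \<open>g e\<close> in \<open>c\<close>. In the end no
  embedding is left, so in some step the number of embeddings drops by a factor below \<open>\<eta>/2\<close>. In that step
  the positions of all vertices outside \<open>e\<close> can be fixed so that the possible images of \<open>e\<close> form a set
  \<open>B\<close> of at least \<open>\<delta>n\<^sup>2\<close> edges of which at most \<open>\<eta>|B|\<close> have colour \<open>g e\<close> in \<open>c\<close>. Removing \<open>g e\<close> from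
  \<open>t\<close> on the other edges of \<open>B\<close> gives a smaller template realised by \<open>c\<close>. Since \<open>B\<close> depends only on \<open>t\<close>
  and on \<open>c\<close> at the edges meeting the fixed vertices, there are only \<open>2 powr O(n)\<close> candidates for \<open>B\<close>, and
  iterating yields few containers. Their entropy is bounded by averaging over \<open>N\<close>-sets with
  \<open>ex(N) / (N choose 2)\<close> close to \<open>\<pi>\<close>. For stability, containers of entropy at most
  \<open>(\<pi> - \<delta>) (n choose 2)\<close> together cover a negligible fraction of \<open>Q n\<close>, and all others are close to the
  stability family.\<close>

section \<open>Increasing enumerations and restrictions\<close>

lemma finite_edges [simp]: "finite (edges n)"
  by (simp add: edges_def finite_imp_finite_nsets)

lemma card_edges: "card (edges n) = n choose 2"
  by (simp add: edges_def card_nsets)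

lemma edges_iff: "e \<in> edges n \<longleftrightarrow> e \<subseteq> {1..n} \<and> card e = 2"
  by (auto simp: edges_def nsets_def intro: finite_subset)

lemma strict_mono_on_elt:
  assumes "finite A"
  shows "strict_mono_on {1..card A} (elt A)"
proof (rule strict_mono_onI)
  fix r s assume "r \<in> {1..card A}" "s \<in> {1..card A}" "r < s"
  then have "r - 1 < s - 1" "s - 1 < length (sorted_list_of_set A)" by auto
  then show "elt A r < elt A s"
    unfolding elt_def using sorted_wrt_nth_less[OF strict_sorted_list_of_set[of A]] by blast
qed

lemma elt_image:
  assumes "finite A"
  shows "elt A ` {1..card A} = A"
proof -
  have "elt A ` {1..card A} = (!) (sorted_list_of_set A) ` {0..<card A}"
    unfolding elt_def by (force simp: image_iff Bex_def intro: exI[of _ "Suc _"])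
  also have "\<dots> = set (sorted_list_of_set A)"
    by (metis image_set length_sorted_list_of_set map_nth set_upt)
  finally show ?thesis using assms by simp
qed

lemma elt_mem: "finite A \<Longrightarrow> i \<in> {1..card A} \<Longrightarrow> elt A i \<in> A"
  using elt_image by blast

lemma elt_image_strict_mono:
  assumes f: "strict_mono_on {1..N} f" and i: "i \<in> {1..N}"
  shows "elt (f ` {1..N}) i = f i"
proof -
  have "sorted_list_of_set (f ` {1..N}) = map f [1..<Suc N]"
  proof (rule sorted_distinct_set_unique)
    have "sorted_wrt (<) (map f [1..<Suc N])"
      unfolding sorted_wrt_map
      by (rule sorted_wrt_mono_rel[OF _ sorted_wrt_upt]) (auto intro: strict_mono_onD[OF f])
    then show "sorted (map f [1..<Suc N])" "distinct (map f [1..<Suc N])"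
      using strict_sorted_iff by blast+
  qed auto
  then have "elt (f ` {1..N}) i = map f [1..<Suc N] ! (i - 1)" by (simp only: elt_def)
  also have "\<dots> = f ([1..<Suc N] ! (i - 1))" using i by (intro nth_map) auto
  also have "[1..<Suc N] ! (i - 1) = i" using i by (subst nth_upt) auto
  finally show ?thesis .
qed

lemma card_image_strict_mono:
  assumes "strict_mono_on {1..N::nat} (f :: nat \<Rightarrow> nat)"
  shows "card (f ` {1..N}) = N"
  using card_image[OF strict_mono_on_imp_inj_on[OF assms]] by simp

lemma image_in_edges:
  assumes "inj_on f {1..N}" "f ` {1..N} \<subseteq> {1..n}" "e \<in> edges N"
  shows "f ` e \<in> edges n"
  using assms by (auto simp: edges_iff card_image inj_on_subset)

lemma inj_on_elt: "finite A \<Longrightarrow> inj_on (elt A) {1..card A}"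
  using strict_mono_on_elt strict_mono_on_imp_inj_on by blast

lemma elt_edge:
  assumes "A \<subseteq> {1..n}" "e \<in> edges (card A)"
  shows "elt A ` e \<in> edges n" "elt A ` e \<subseteq> A"
proof -
  have "finite A" using assms finite_subset by blast
  then show "elt A ` e \<in> edges n"
    using assms elt_image[of A] by (intro image_in_edges[OF inj_on_elt]) blast+
  show "elt A ` e \<subseteq> A"
    using assms elt_image[OF \<open>finite A\<close>] unfolding edges_iff by blast
qed

lemma restr_apply: "e \<in> edges (card A) \<Longrightarrow> restr c A e = c (elt A ` e)"
  by (simp add: restr_def)

lemma restr_image:
  assumes "strict_mono_on {1..N} f"
  shows "restr c (f ` {1..N}) = restrict (\<lambda>e. c (f ` e)) (edges N)"
proof -
  have "elt (f ` {1..N}) ` e = f ` e" if "e \<in> edges N" for e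
    using that elt_image_strict_mono[OF assms] unfolding edges_iff by (intro image_cong) auto
  then show ?thesis
    unfolding restr_def card_image_strict_mono[OF assms] by (intro restrict_ext) simp
qed

text \<open>With \<open>A'\<close> the positions of \<open>A\<close> inside \<open>B\<close>, the
  map \<open>elt B \<circ> elt A'\<close> is increasing with image \<open>A\<close>, so it is the
  increasing enumeration of \<open>A\<close>. This lets heredity pass from \<open>B\<close> to
  \<open>A\<close>.\<close>

lemma restr_restr:
  assumes "finite B" "A \<subseteq> B"
  obtains A' where "A' \<subseteq> {1..card B}" "card A' = card A" "restr (restr c B) A' = restr c A"
proof
  define A' where "A' = {i \<in> {1..card B}. elt B i \<in> A}"
  have A: "elt B ` A' = A"
  proof (intro equalityI subsetI)
    fix x assume "x \<in> A"
    then obtain i where "i \<in> {1..card B}" "x = elt B i"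
      using elt_image[OF assms(1)] assms(2) by blast
    then show "x \<in> elt B ` A'" using \<open>x \<in> A\<close> by (auto simp: A'_def)
  qed (auto simp: A'_def)
  have inj: "inj_on (elt B) A'"
    using inj_on_elt[OF assms(1)] by (rule inj_on_subset) (auto simp: A'_def)
  show sub: "A' \<subseteq> {1..card B}" by (auto simp: A'_def)
  show card: "card A' = card A" using card_image[OF inj] A by simp
  have fin: "finite A'" using sub finite_subset by blast
  have mono: "strict_mono_on {1..card A} (elt B \<circ> elt A')"
  proof (rule strict_mono_onI)
    fix r s assume rs: "r \<in> {1..card A}" "s \<in> {1..card A}" "r < s"
    then have "elt A' r < elt A' s"
      by (intro strict_mono_onD[OF strict_mono_on_elt[OF fin]]) (simp_all only: card)
    moreover have "elt A' r \<in> {1..card B}" "elt A' s \<in> {1..card B}"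
      by (rule subsetD[OF sub], rule elt_mem[OF fin], unfold card, fact rs)+
    ultimately show "(elt B \<circ> elt A') r < (elt B \<circ> elt A') s"
      unfolding comp_def by (intro strict_mono_onD[OF strict_mono_on_elt[OF assms(1)]])
  qed
  have im: "(elt B \<circ> elt A') ` {1..card A} = A"
    using A elt_image[OF fin] card by (metis image_comp)
  have "restr c A = restrict (\<lambda>e. c ((elt B \<circ> elt A') ` e)) (edges (card A))"
    using restr_image[OF mono, of c] im by simp
  moreover have "restr (restr c B) A' = restrict (\<lambda>e. c (elt B ` elt A' ` e)) (edges (card A))"
    unfolding restr_def[of _ A'] card
    using elt_edge(1)[OF sub] card by (auto simp: restr_def)
  ultimately show "restr (restr c B) A' = restr c A" by (simp add: image_comp)
qed

section \<open>Edges inside a subset and restricted templates\<close>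

lemma edge_in_subset:
  assumes "A \<subseteq> {1..n}"
  shows "(\<lambda>e. elt A ` e) ` edges (card A) = {e \<in> edges n. e \<subseteq> A}" (is "?f ` _ = ?R")
    and "inj_on (\<lambda>e. elt A ` e) (edges (card A))"
proof -
  have fin: "finite A" using assms finite_subset by blast
  show "inj_on ?f (edges (card A))"
    using inj_on_elt[OF fin] by (intro inj_onI) (metis edges_iff inj_on_image_eq_iff)
  show "?f ` edges (card A) = ?R"
  proof (intro equalityI subsetI)
    fix e assume "e \<in> ?f ` edges (card A)"
    then show "e \<in> ?R" using elt_edge[OF assms] by auto
  next
    fix e assume e: "e \<in> ?R"
    then obtain e' where e': "e' \<subseteq> {1..card A}" "e = elt A ` e'"
      using elt_image[OF fin] by (metis (no_types, lifting) mem_Collect_eq subset_image_iff)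
    then have "card e' = card e"
      using card_image[of "elt A" e'] inj_on_subset[OF inj_on_elt[OF fin]] by auto
    then show "e \<in> ?f ` edges (card A)"
      using e e' by (auto simp: edges_iff)
  qed
qed

text \<open>Edges not inside \<open>A\<close> may take any allowed colour, because templates have no
  empty values. Badness of a set can therefore be judged from global and from local realisations
  alike.\<close>

lemma realisation_extend:
  assumes t: "t \<in> templates \<Sigma> n" and A: "A \<subseteq> {1..n}"
    and c: "c \<in> realisations (card A) (restr t A)"
  obtains c' where "c' \<in> realisations n t" "restr c' A = c"
proof
  let ?f = "\<lambda>e. elt A ` e"
  define c' where "c' = restrict (\<lambda>e. if e \<subseteq> A then c (the_inv_into (edges (card A)) ?f e)
     else (SOME x. x \<in> t e)) (edges n)"
  have inv: "c' (elt A ` e) = c e" if "e \<in> edges (card A)" for e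
    using elt_edge[OF A that] the_inv_into_f_f[OF edge_in_subset(2)[OF A] that]
    by (simp add: c'_def)
  show "restr c' A = c"
    using c inv by (intro ext) (auto simp: restr_def realisations_def PiE_def extensional_def)
  show "c' \<in> realisations n t"
    unfolding realisations_def
  proof (rule PiE_I)
    fix e assume e: "e \<in> edges n"
    show "c' e \<in> t e"
    proof (cases "e \<subseteq> A")
      case True
      then obtain e' where e': "e' \<in> edges (card A)" "e = elt A ` e'"
        using e edge_in_subset(1)[OF A] by blast
      have "c e' \<in> restr t A e'" using c e' by (auto simp: realisations_def)
      then show ?thesis using e' inv by (simp add: restr_apply)
    next
      case False
      then have "c' e = (SOME x. x \<in> t e)" using e by (simp add: c'_def)
      moreover have "t e \<noteq> {}" using t e by (auto simp: templates_def)
      ultimately show ?thesis by (simp add: some_in_eq)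
    qed
  qed (simp add: c'_def)
qed

lemma restr_realisation:
  assumes "c \<in> realisations n t" "A \<subseteq> {1..n}"
  shows "restr c A \<in> realisations (card A) (restr t A)"
  using assms elt_edge(1)[OF assms(2)] by (auto simp: realisations_def restr_def)

lemma restr_template:
  assumes "t \<in> templates \<Sigma> n" "A \<subseteq> {1..n}"
  shows "restr t A \<in> templates \<Sigma> (card A)"
proof -
  have "t (elt A ` e) \<in> Pow \<Sigma> - {{}}" if "e \<in> edges (card A)" for e
    using assms(1) elt_edge(1)[OF assms(2) that] unfolding templates_def by (rule PiE_mem)
  then show ?thesis by (simp add: templates_def restr_def)
qed

lemma Ent_restr:
  assumes "A \<subseteq> {1..n}"
  shows "Ent \<Sigma> (card A) (restr t A) =
    (\<Sum>e | e \<in> edges n \<and> e \<subseteq> A. log (real (card \<Sigma>)) (real (card (t e))))"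
  unfolding Ent_def edge_in_subset(1)[OF assms, symmetric]
  by (subst sum.reindex[OF edge_in_subset(2)[OF assms]]) (simp add: restr_apply)

lemma card_supersets:
  assumes "e \<subseteq> {1..n}" "card e = j" "j \<le> N" "N \<le> n"
  shows "card {A \<in> nsets {1..n} N. e \<subseteq> A} = (n - j) choose (N - j)"
proof -
  have fe: "finite e" using assms finite_subset by blast
  have "bij_betw (\<lambda>B. B \<union> e) (nsets ({1..n} - e) (N - j)) {A \<in> nsets {1..n} N. e \<subseteq> A}"
  proof (rule bij_betw_byWitness[where f' = "\<lambda>A. A - e"])
    show "(\<lambda>B. B \<union> e) ` nsets ({1..n} - e) (N - j) \<subseteq> {A \<in> nsets {1..n} N. e \<subseteq> A}"
    proof clarify
      fix B assume "B \<in> nsets ({1..n} - e) (N - j)"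
      then have "B \<subseteq> {1..n} - e" "finite B" "card B = N - j" by (auto simp: nsets_def)
      moreover from this have "card (B \<union> e) = N" using assms fe by (subst card_Un_disjoint) auto
      ultimately show "B \<union> e \<in> nsets {1..n} N \<and> e \<subseteq> B \<union> e" using assms fe by (auto simp: nsets_def)
    qed
  qed (use assms fe in \<open>auto simp: nsets_def card_Diff_subset\<close>)
  then have "card {A \<in> nsets {1..n} N. e \<subseteq> A} = card ({1..n} - e) choose (N - j)"
    by (simp add: bij_betw_same_card[symmetric] card_nsets)
  also have "card ({1..n} - e) = n - j"
    using assms fe by (subst card_Diff_subset) auto
  finally show ?thesis .
qed

section \<open>Embedding a forbidden colouring edge by edge\<close>

text \<open>Increasing maps stand for the \<open>N\<close>-subsets of \<open>{1..n}\<close>: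
  restriction relabels a subset in increasing order, so copies of a colouring are increasing
  embeddings.\<close>

definition increasing_maps :: "nat \<Rightarrow> nat \<Rightarrow> (nat \<Rightarrow> nat) set" where
  "increasing_maps N n = {\<phi> \<in> {1..N} \<rightarrow>\<^sub>E {1..n}. strict_mono_on {1..N} \<phi>}"

text \<open>\<open>X\<close> is the set of edges already demanded to have the right colour in
  \<open>c\<close>. For \<open>X = {}\<close> the set does not depend on \<open>c\<close>; for
  \<open>X = edges N\<close> it consists of the embeddings of \<open>g\<close> into \<open>c\<close>
  itself.\<close>

definition copies ::
    "nat \<Rightarrow> nat \<Rightarrow> template \<Rightarrow> colouring \<Rightarrow> colouring \<Rightarrow> nat set set \<Rightarrow> (nat \<Rightarrow> nat) set" where
  "copies N n t c g X = {\<phi> \<in> increasing_maps N n.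
     (\<forall>e\<in>X. c (\<phi> ` e) = g e) \<and> (\<forall>e\<in>edges N - X. g e \<in> t (\<phi> ` e))}"

text \<open>Only the values of \<open>z\<close> outside \<open>e\<close> matter: they fix the other
  vertices, and the link lists the positions left for the edge \<open>e\<close>.\<close>

definition link ::
    "nat \<Rightarrow> nat \<Rightarrow> template \<Rightarrow> colouring \<Rightarrow> colouring \<Rightarrow> nat set set \<Rightarrow> nat set \<Rightarrow> (nat \<Rightarrow> nat) \<Rightarrow>
      nat set set" where
  "link N n t c g X e z =
     (\<lambda>\<phi>. \<phi> ` e) ` {\<phi> \<in> copies N n t c g X. \<forall>i\<in>{1..N} - e. \<phi> i = z i}"

lemma finite_increasing_maps [simp]: "finite (increasing_maps N n)"
  unfolding increasing_maps_def by (rule finite_subset[of _ "{1..N} \<rightarrow>\<^sub>E {1..n}"]) (auto intro: finite_PiE)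

lemma finite_copies [simp]: "finite (copies N n t c g X)"
  unfolding copies_def by simp

lemma increasing_map_edge:
  assumes "\<phi> \<in> increasing_maps N n" "e \<in> edges N"
  shows "\<phi> ` e \<in> edges n"
proof (rule image_in_edges)
  show "inj_on \<phi> {1..N}"
    using assms strict_mono_on_imp_inj_on by (auto simp: increasing_maps_def)
  show "\<phi> ` {1..N} \<subseteq> {1..n}"
    using assms(1) unfolding increasing_maps_def PiE_def Pi_def by blast
qed (fact assms)

lemma link_subset_edges:
  assumes "e \<in> edges N"
  shows "link N n t c g X e z \<subseteq> edges n"
  using increasing_map_edge[OF _ assms] by (auto simp: link_def copies_def)

lemma strict_mono_on_image_doubleton_eq:
  fixes \<phi> \<psi> :: "nat \<Rightarrow> nat"
  assumes "strict_mono_on A \<phi>" "strict_mono_on A \<psi>" "e \<subseteq> A" "card e = 2" "\<phi> ` e = \<psi> ` e" "i \<in> e"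
  shows "\<phi> i = \<psi> i"
proof -
  obtain a b where e: "e = {a, b}" "a < b"
    using assms(4) by (metis card_2_iff doubleton_eq_iff neq_iff)
  have "\<phi> a < \<phi> b" "\<psi> a < \<psi> b"
    using assms(1-3) e by (auto intro: strict_mono_onD)
  moreover have "{\<phi> a, \<phi> b} = {\<psi> a, \<psi> b}"
    using assms(5) e by simp
  ultimately have "\<phi> a = \<psi> a" "\<phi> b = \<psi> b"
    by (auto simp: doubleton_eq_iff)
  then show ?thesis using assms(6) e by auto
qed

text \<open>An increasing map sends the smaller end of an edge to the smaller end of its image, so
  the image set determines both values. Links thus count embeddings without loss.\<close>

lemma inj_on_image_edge:
  assumes e: "e \<in> edges N"
  shows "inj_on (\<lambda>\<phi>. \<phi> ` e) {\<phi> \<in> increasing_maps N n. \<forall>i\<in>{1..N} - e. \<phi> i = z i}"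
proof (rule inj_onI)
  fix \<phi> \<psi>
  assume \<phi>: "\<phi> \<in> {\<phi> \<in> increasing_maps N n. \<forall>i\<in>{1..N} - e. \<phi> i = z i}"
    and \<psi>: "\<psi> \<in> {\<phi> \<in> increasing_maps N n. \<forall>i\<in>{1..N} - e. \<phi> i = z i}"
    and eq: "\<phi> ` e = \<psi> ` e"
  have mono: "strict_mono_on {1..N} \<phi>" "strict_mono_on {1..N} \<psi>"
    using \<phi> \<psi> by (auto simp: increasing_maps_def)
  have "\<phi> i = \<psi> i" if "i \<in> {1..N}" for i
  proof (cases "i \<in> e")
    case True
    then show ?thesis
      using strict_mono_on_image_doubleton_eq[OF mono _ _ eq] e by (auto simp: edges_iff)
  qed (use \<phi> \<psi> that in auto)
  then show "\<phi> = \<psi>"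
    using \<phi> \<psi> unfolding increasing_maps_def by (blast intro: PiE_ext[of \<phi> _ "\<lambda>_. {1..n}"])
qed

text \<open>Embeddings are grouped by their restriction to the vertices outside \<open>e\<close>;
  within a group an embedding is determined by the image of \<open>e\<close>, so the group is in
  bijection with a link.\<close>

lemma card_copies_fibres:
  assumes e: "e \<in> edges N"
  shows "card (copies N n t c g X) =
    (\<Sum>z\<in>{1..N} - e \<rightarrow>\<^sub>E {1..n}. card (link N n t c g X e z))"
    and "card {\<phi> \<in> copies N n t c g X. P (\<phi> ` e)} =
    (\<Sum>z\<in>{1..N} - e \<rightarrow>\<^sub>E {1..n}. card {x \<in> link N n t c g X e z. P x})"
proof -
  have main: "card {\<phi> \<in> copies N n t c g X. P (\<phi> ` e)} =
    (\<Sum>z\<in>{1..N} - e \<rightarrow>\<^sub>E {1..n}. card {x \<in> link N n t c g X e z. P x})" for P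
  proof -
    let ?S = "{\<phi> \<in> copies N n t c g X. P (\<phi> ` e)}"
    let ?Z = "{1..N} - e \<rightarrow>\<^sub>E {1..n}"
    let ?r = "\<lambda>\<phi>. restrict \<phi> ({1..N} - e)"
    have fin: "finite ?S" "finite ?Z" by (auto intro: finite_PiE)
    have "?r ` ?S \<subseteq> ?Z"
    proof (intro image_subsetI restrict_PiE_iff[THEN iffD2] ballI)
      fix \<phi> i assume "\<phi> \<in> ?S" "i \<in> {1..N} - e"
      then show "\<phi> i \<in> {1..n}"
        unfolding copies_def increasing_maps_def by (blast intro: PiE_mem)
    qed
    then have "card ?S = (\<Sum>z\<in>?Z. \<Sum>\<phi>\<in>{\<phi>\<in>?S. ?r \<phi> = z}. 1)"
      unfolding card_eq_sum using sum.group[OF fin, of ?r "\<lambda>_. 1::nat"] by (simp only:)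
    also have "\<dots> = (\<Sum>z\<in>?Z. card {x \<in> link N n t c g X e z. P x})"
    proof (rule sum.cong[OF refl])
      fix z assume z: "z \<in> ?Z"
      have "?r \<phi> = z \<longleftrightarrow> (\<forall>i\<in>{1..N} - e. \<phi> i = z i)" for \<phi>
      proof
        assume "?r \<phi> = z"
        then show "\<forall>i\<in>{1..N} - e. \<phi> i = z i" by auto
      next
        assume "\<forall>i\<in>{1..N} - e. \<phi> i = z i"
        then have "?r \<phi> = ?r z" by (intro restrict_ext) blast
        then show "?r \<phi> = z" using PiE_restrict[OF z] by (simp only:)
      qed
      then have fib: "{\<phi>\<in>?S. ?r \<phi> = z} = {\<phi>\<in>?S. \<forall>i\<in>{1..N} - e. \<phi> i = z i}"
        by simp
      have inj: "inj_on (\<lambda>\<phi>. \<phi> ` e) {\<phi>\<in>?S. \<forall>i\<in>{1..N} - e. \<phi> i = z i}"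
        using inj_on_image_edge[OF e, of n z] by (rule inj_on_subset) (auto simp: copies_def)
      have "(\<lambda>\<phi>. \<phi> ` e) ` {\<phi>\<in>?S. \<forall>i\<in>{1..N} - e. \<phi> i = z i} = {x \<in> link N n t c g X e z. P x}"
        by (auto simp: link_def)
      then show "(\<Sum>\<phi>\<in>{\<phi>\<in>?S. ?r \<phi> = z}. 1) = card {x \<in> link N n t c g X e z. P x}"
        using card_image[OF inj] fib by simp
    qed
    finally show ?thesis .
  qed
  show "card (copies N n t c g X) =
    (\<Sum>z\<in>{1..N} - e \<rightarrow>\<^sub>E {1..n}. card (link N n t c g X e z))"
    using main[of "\<lambda>_. True"] by simp
  show "card {\<phi> \<in> copies N n t c g X. P (\<phi> ` e)} =
    (\<Sum>z\<in>{1..N} - e \<rightarrow>\<^sub>E {1..n}. card {x \<in> link N n t c g X e z. P x})"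
    by (rule main)
qed

text \<open>There are \<open>n ^ (N - 2)\<close> choices of \<open>z\<close>, so links below the
  threshold \<open>\<gamma> / 2 * n ^ 2\<close> account for at most half of the required embeddings;
  in the other links a share \<open>\<eta>\<close> survives.\<close>

lemma copies_insert_lower_bound:
  assumes e: "e \<in> edges N" "e \<notin> X"
    and many: "\<gamma> * real n ^ N \<le> real (card (copies N n t c g X))"
    and \<eta>: "0 \<le> \<eta>"
    and dense: "\<And>z. \<gamma> / 2 * real n ^ 2 \<le> real (card (link N n t c g X e z)) \<Longrightarrow>
      \<eta> * real (card (link N n t c g X e z)) \<le> real (card {x \<in> link N n t c g X e z. c x = g e})"
    and \<gamma>: "0 \<le> \<gamma>"
  shows "\<eta> / 2 * \<gamma> * real n ^ N \<le> real (card (copies N n t c g (insert e X)))"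
proof -
  let ?Z = "{1..N} - e \<rightarrow>\<^sub>E {1..n}" and ?L = "link N n t c g X e"
  have e2: "e \<subseteq> {1..N}" "card e = 2" using e by (auto simp: edges_iff)
  have fe: "finite e" using e2(1) finite_subset by blast
  have N: "2 \<le> N" using card_mono[OF _ e2(1)] e2(2) by simp
  have cZ: "card ?Z = n ^ (N - 2)"
    using e2 fe by (simp add: card_funcsetE card_Diff_subset)
  have "\<eta> / 2 * \<gamma> * real n ^ N = \<eta> * (\<gamma> * real n ^ N - real (n ^ (N - 2)) * (\<gamma> / 2 * real n ^ 2))"
  proof -
    have "real n ^ N = real n ^ (N - 2) * real n ^ 2"
      using N by (metis le_add_diff_inverse2 power_add)
    then show ?thesis by (simp add: field_simps)
  qed
  also have "\<dots> \<le> \<eta> * ((\<Sum>z\<in>?Z. real (card (?L z))) - (\<Sum>z\<in>?Z. \<gamma> / 2 * real n ^ 2))"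
  proof (rule mult_left_mono[OF _ \<eta>])
    have "(\<Sum>z\<in>?Z. \<gamma> / 2 * real n ^ 2) = real (n ^ (N - 2)) * (\<gamma> / 2 * real n ^ 2)"
      unfolding sum_constant cZ ..
    moreover have "(\<Sum>z\<in>?Z. real (card (?L z))) = real (card (copies N n t c g X))"
      unfolding card_copies_fibres(1)[OF e(1)] by simp
    ultimately show "\<gamma> * real n ^ N - real (n ^ (N - 2)) * (\<gamma> / 2 * real n ^ 2) \<le>
      (\<Sum>z\<in>?Z. real (card (?L z))) - (\<Sum>z\<in>?Z. \<gamma> / 2 * real n ^ 2)"
      using many by linarith
  qed
  also have "\<dots> = (\<Sum>z\<in>?Z. \<eta> * (real (card (?L z)) - \<gamma> / 2 * real n ^ 2))"
    by (simp only: sum_subtractf right_diff_distrib sum_distrib_left)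
  \<comment> \<open>With the threshold subtracted, the bound holds summand by summand: for small
    links its left side is not positive.\<close>
  also have "\<dots> \<le> (\<Sum>z\<in>?Z. real (card {x \<in> ?L z. c x = g e}))"
  proof (rule sum_mono)
    fix z
    show "\<eta> * (real (card (?L z)) - \<gamma> / 2 * real n ^ 2) \<le> real (card {x \<in> ?L z. c x = g e})"
    proof (cases "\<gamma> / 2 * real n ^ 2 \<le> real (card (?L z))")
      case True
      have "\<eta> * (real (card (?L z)) - \<gamma> / 2 * real n ^ 2) \<le> \<eta> * real (card (?L z))"
        using \<eta> \<gamma> by (intro mult_left_mono) auto
      then show ?thesis using dense[OF True] by linarith
    next
      case False
      then have "\<eta> * (real (card (?L z)) - \<gamma> / 2 * real n ^ 2) \<le> 0"
        using \<eta> by (intro mult_nonneg_nonpos) auto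
      then show ?thesis by linarith
    qed
  qed
  also have "\<dots> = real (card {\<phi> \<in> copies N n t c g X. c (\<phi> ` e) = g e})"
    using card_copies_fibres(2)[OF e(1), of n t c g X "\<lambda>x. c x = g e"] by simp
  also have "\<dots> \<le> real (card (copies N n t c g (insert e X)))"
    by (intro of_nat_mono card_mono) (auto simp: copies_def)
  finally show ?thesis .
qed

text \<open>If every large link were dense, demanding the edges of \<open>K_N\<close> one after the
  other would keep a factor \<open>\<eta> / 2\<close> of the embeddings each time and leave a full
  copy of \<open>g\<close> in \<open>c\<close>.\<close>

lemma sparse_link_exists:
  assumes many: "\<gamma> * real n ^ N \<le> real (card (copies N n t c g {}))"
    and pos: "0 < \<gamma>" "0 < n" "0 < \<eta>" "\<eta> \<le> 1"
    and none: "copies N n t c g (edges N) = {}"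
  obtains X e z where "X \<subseteq> edges N" "e \<in> edges N" "e \<notin> X"
    "(\<eta> / 2) ^ (N choose 2) * \<gamma> / 2 * real n ^ 2 \<le> real (card (link N n t c g X e z))"
    "real (card {x \<in> link N n t c g X e z. c x = g e}) \<le> \<eta> * real (card (link N n t c g X e z))"
proof (rule ccontr)
  note obt = that
  assume "\<not> thesis"
  have dense: "\<eta> * real (card (link N n t c g X e z)) \<le> real (card {x \<in> link N n t c g X e z. c x = g e})"
    if "X \<subseteq> edges N" "e \<in> edges N" "e \<notin> X"
      "(\<eta> / 2) ^ (N choose 2) * \<gamma> / 2 * real n ^ 2 \<le> real (card (link N n t c g X e z))" for X e z
  proof (rule ccontr)
    assume "\<not> ?thesis"
    then have "real (card {x \<in> link N n t c g X e z. c x = g e}) \<le> \<eta> * real (card (link N n t c g X e z))"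
      by linarith
    from obt[OF that this] \<open>\<not> thesis\<close> show False by contradiction
  qed
  have "(\<eta> / 2) ^ card X * \<gamma> * real n ^ N \<le> real (card (copies N n t c g X))" if "X \<subseteq> edges N" for X
  proof -
    have "finite X" by (rule finite_subset[OF that finite_edges])
    then show ?thesis using that
    proof (induction X rule: finite_induct)
      case empty
      then show ?case using many by simp
    next
      case (insert e X)
      have "card (edges N) \<ge> card X" using insert.prems by (intro card_mono) auto
      \<comment> \<open>The threshold carries the exponent of the last stage. As
        \<open>\<eta> / 2 \<le> 1\<close>, it is the smallest of all stages and serves each of
        them.\<close>
      then have pow: "(\<eta> / 2) ^ (N choose 2) \<le> (\<eta> / 2) ^ card X"
        using pos by (intro power_decreasing) (auto simp flip: card_edges)
      have "\<eta> / 2 * ((\<eta> / 2) ^ card X * \<gamma>) * real n ^ N \<le> real (card (copies N n t c g (insert e X)))"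
      proof (rule copies_insert_lower_bound)
        fix z
        assume *: "(\<eta> / 2) ^ card X * \<gamma> / 2 * real n ^ 2 \<le> real (card (link N n t c g X e z))"
        have "(\<eta> / 2) ^ (N choose 2) * \<gamma> / 2 * real n ^ 2 \<le> (\<eta> / 2) ^ card X * \<gamma> / 2 * real n ^ 2"
          using pow pos by (intro mult_right_mono divide_right_mono) auto
        with * show "\<eta> * real (card (link N n t c g X e z)) \<le> real (card {x \<in> link N n t c g X e z. c x = g e})"
          using insert.prems insert.hyps by (intro dense) auto
      qed (use insert.prems insert.hyps insert.IH pos in auto)
      then show ?case using insert.hyps by (simp add: mult.assoc)
    qed
  qed
  from this[of "edges N"] none have "(\<eta> / 2) ^ (N choose 2) * \<gamma> * real n ^ N \<le> 0"
    by (simp add: card_edges)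
  moreover have "0 < (\<eta> / 2) ^ (N choose 2) * \<gamma> * real n ^ N" using pos by simp
  ultimately show False by linarith
qed

section \<open>Edges at the fixed vertices and the number of possible links\<close>

definition star :: "nat \<Rightarrow> nat \<Rightarrow> (nat \<Rightarrow> nat) \<Rightarrow> nat set set" where
  "star N n z = {x \<in> edges n. x \<inter> z ` {1..N} \<noteq> {}}"

lemma card_star: "card (star N n z) \<le> N * n"
proof -
  have "star N n z \<subseteq> (\<lambda>(i, v). {z i, v}) ` ({1..N} \<times> {1..n})"
  proof
    fix x assume x: "x \<in> star N n z"
    then obtain i where i: "i \<in> {1..N}" "z i \<in> x" 
      unfolding star_def by (simp del: atLeastAtMost_iff, blast)
    have x2: "x \<subseteq> {1..n}" "card x = 2" using x by (auto simp: star_def edges_iff)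
    then obtain a b where "x = {a, b}" by (auto simp: card_2_iff)
    then obtain v where "x = {z i, v}"
      using i(2) by blast
    then show "x \<in> (\<lambda>(i, v). {z i, v}) ` ({1..N} \<times> {1..n})"
      using i x2 by (auto intro!: image_eqI[of _ _ "(i, v)"])
  qed
  then have "card (star N n z) \<le> card ((\<lambda>(i, v). {z i, v}) ` ({1..N} \<times> {1..n}))"
    by (intro card_mono) auto
  also have "\<dots> \<le> card ({1..N} \<times> {1..n})" by (intro card_image_le) auto
  finally show ?thesis by simp
qed

text \<open>An edge of \<open>X\<close> differs from \<open>e\<close> and has the same size, so it
  has an end outside \<open>e\<close> and its image meets the fixed vertices. A link thus sees
  \<open>c\<close> on at most \<open>N * n\<close> edges, which keeps the number of links at 2 powr
  O(n).\<close>

lemma link_restrict_star: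
  assumes X: "X \<subseteq> edges N" and e: "e \<in> edges N" "e \<notin> X"
  shows "link N n t c g X e z = link N n t (restrict c (star N n z)) g X e z"
proof -
  have "c (\<phi> ` x) = restrict c (star N n z) (\<phi> ` x)"
    if \<phi>: "\<phi> \<in> increasing_maps N n" "\<forall>i\<in>{1..N} - e. \<phi> i = z i" and x: "x \<in> X" for \<phi> x
  proof -
    have x': "x \<in> edges N" "x \<noteq> e" using x X e by auto
    moreover have "finite e" "card x = card e"
      using e(1) x'(1) finite_subset[of e "{1..N}"] by (auto simp: edges_iff)
    ultimately have "\<not> x \<subseteq> e" using card_subset_eq by blast
    then obtain i where i: "i \<in> x" "i \<notin> e" by blast
    then have "\<phi> i = z i" "i \<in> {1..N}" using \<phi> x' by (auto simp: edges_iff)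
    then have "\<phi> ` x \<in> star N n z"
      using increasing_map_edge[OF \<phi>(1) x'(1)] i by (auto simp: star_def)
    then show ?thesis by simp
  qed
  then have "{\<phi> \<in> copies N n t c g X. \<forall>i\<in>{1..N} - e. \<phi> i = z i} =
    {\<phi> \<in> copies N n t (restrict c (star N n z)) g X. \<forall>i\<in>{1..N} - e. \<phi> i = z i}"
    unfolding copies_def by auto
  then show ?thesis unfolding link_def by simp
qed

text \<open>A colouring \<open>d\<close> of the star replaces the unknown \<open>c\<close>, so that
  all candidates for a sparse link and its colour are listed from \<open>t\<close> alone.\<close>

definition links :: "nat set \<Rightarrow> nat \<Rightarrow> nat \<Rightarrow> template \<Rightarrow> (nat set set \<times> nat) set" where
  "links \<Sigma> N n t = (\<lambda>((g, X, e), z, d). (link N n t d g X e z, g e)) `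
     (((edges N \<rightarrow>\<^sub>E \<Sigma>) \<times> Pow (edges N) \<times> edges N) \<times>
      (SIGMA z:{1..N} \<rightarrow>\<^sub>E {1..n}. star N n z \<rightarrow>\<^sub>E \<Sigma>))"

lemma card_links:
  assumes \<Sigma>: "finite \<Sigma>" "\<Sigma> \<noteq> {}"
  shows "finite (links \<Sigma> N n t)"
    and "card (links \<Sigma> N n t) \<le>
      card \<Sigma> ^ (N choose 2) * 2 ^ (N choose 2) * (N choose 2) * (n ^ N * card \<Sigma> ^ (N * n))"
proof -
  let ?D = "SIGMA z:{1..N} \<rightarrow>\<^sub>E {1..n}. star N n z \<rightarrow>\<^sub>E \<Sigma>"
  let ?G = "(edges N \<rightarrow>\<^sub>E \<Sigma>) \<times> Pow (edges N) \<times> edges N"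
  have fs: "finite (star N n z)" for z by (simp add: star_def)
  have fin: "finite ?D" "finite ?G" using \<Sigma>(1) fs by (auto intro!: finite_PiE)
  then show "finite (links \<Sigma> N n t)" unfolding links_def by blast
  have "card \<Sigma> > 0" using \<Sigma> by (simp add: card_gt_0_iff)
  have "card ?D = (\<Sum>z\<in>{1..N} \<rightarrow>\<^sub>E {1..n}. card \<Sigma> ^ card (star N n z))"
    using \<Sigma>(1) fs by (subst card_SigmaI) (auto intro!: finite_PiE simp: card_funcsetE)
  also have "\<dots> \<le> (\<Sum>z\<in>{1..N} \<rightarrow>\<^sub>E {1..n}. card \<Sigma> ^ (N * n))"
    using \<open>card \<Sigma> > 0\<close> by (intro sum_mono power_increasing card_star) auto
  also have "\<dots> = n ^ N * card \<Sigma> ^ (N * n)" by (simp add: card_funcsetE)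
  finally have D: "card ?D \<le> n ^ N * card \<Sigma> ^ (N * n)" .
  have G: "card ?G = card \<Sigma> ^ (N choose 2) * 2 ^ (N choose 2) * (N choose 2)"
    by (simp add: card_cartesian_product card_funcsetE card_Pow card_edges)
  have "card (links \<Sigma> N n t) \<le> card (?G \<times> ?D)"
    unfolding links_def using fin by (intro card_image_le) blast
  also have "\<dots> = card ?G * card ?D" by (simp add: card_cartesian_product)
  finally show "card (links \<Sigma> N n t) \<le>
      card \<Sigma> ^ (N choose 2) * 2 ^ (N choose 2) * (N choose 2) * (n ^ N * card \<Sigma> ^ (N * n))"
    using mult_le_mono2[OF D, of "card ?G"] unfolding G by linarith
qed

lemma sparse_link_in_links:
  assumes g: "g \<in> edges N \<rightarrow>\<^sub>E \<Sigma>" and c: "c \<in> edges n \<rightarrow>\<^sub>E \<Sigma>"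
    and many: "\<gamma> * real n ^ N \<le> real (card (copies N n t c g {}))"
    and pos: "0 < \<gamma>" "0 < n" "0 < \<eta>" "\<eta> \<le> 1"
    and none: "copies N n t c g (edges N) = {}"
  obtains B \<sigma> where "(B, \<sigma>) \<in> links \<Sigma> N n t" "B \<subseteq> edges n" "\<forall>x\<in>B. \<sigma> \<in> t x"
    "(\<eta> / 2) ^ (N choose 2) * \<gamma> / 2 * real n ^ 2 \<le> real (card B)"
    "real (card {x \<in> B. c x = \<sigma>}) \<le> \<eta> * real (card B)"
proof -
  obtain X e z where X: "X \<subseteq> edges N" and e: "e \<in> edges N" "e \<notin> X"
    and big: "(\<eta> / 2) ^ (N choose 2) * \<gamma> / 2 * real n ^ 2 \<le> real (card (link N n t c g X e z))"
    and sparse: "real (card {x \<in> link N n t c g X e z. c x = g e}) \<le> \<eta> * real (card (link N n t c g X e z))"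
    using sparse_link_exists[OF many pos none] by blast
  have "0 < (\<eta> / 2) ^ (N choose 2) * \<gamma> / 2 * real n ^ 2" using pos by simp
  then have "link N n t c g X e z \<noteq> {}" using big by auto
  then obtain \<phi> where \<phi>: "\<phi> \<in> copies N n t c g X" "\<forall>i\<in>{1..N} - e. \<phi> i = z i"
    by (auto simp: link_def)
  \<comment> \<open>The arbitrary \<open>z\<close> is traded for an embedding that agrees with it
    outside \<open>e\<close> and has the range that \<open>links\<close> requires.\<close>
  have z: "link N n t c g X e z = link N n t c g X e \<phi>"
    using \<phi>(2) by (auto simp: link_def)
  have \<phi>': "\<phi> \<in> {1..N} \<rightarrow>\<^sub>E {1..n}" using \<phi>(1) by (auto simp: copies_def increasing_maps_def)
  have d: "restrict c (star N n \<phi>) \<in> star N n \<phi> \<rightarrow>\<^sub>E \<Sigma>"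
    using c by (auto simp: star_def)
  have eq: "link N n t c g X e z = link N n t (restrict c (star N n \<phi>)) g X e \<phi>"
    unfolding z by (rule link_restrict_star[OF X e])
  show thesis
  proof (rule that)
    show "(link N n t c g X e z, g e) \<in> links \<Sigma> N n t"
      unfolding links_def eq
      by (rule image_eqI[of _ _ "((g, X, e), \<phi>, restrict c (star N n \<phi>))"]) (use g X e \<phi>' d in auto)
    show "link N n t c g X e z \<subseteq> edges n" by (rule link_subset_edges[OF e(1)])
    show "\<forall>x\<in>link N n t c g X e z. g e \<in> t x" using e by (auto simp: link_def copies_def)
  qed (fact big sparse)+
qed

section \<open>Containers by repeated pruning\<close>

lemma sum_power_card_Pow:
  fixes x :: "'a :: comm_semiring_1"
  assumes "finite B"
  shows "(\<Sum>L\<in>Pow B. x ^ card L) = (1 + x) ^ card B"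
  using prod_add[OF assms, of "\<lambda>_. x" "\<lambda>_. 1"] by (simp add: add.commute)

text \<open>Exponential weighting: for \<open>x \<le> 1\<close> each small \<open>L\<close> has
  weight \<open>x powr (card L - \<eta> * card B) \<ge> 1\<close>, and the weights of all subsets
  sum to \<open>x powr (- \<eta> * card B) * (1 + x) ^ card B\<close>.\<close>

lemma few_small_subsets:
  fixes a :: real
  assumes a: "1 < a"
  obtains \<eta> where "0 < \<eta>" "\<eta> \<le> 1/4"
    "\<And>B :: 'a set. finite B \<Longrightarrow>
      real (card {L \<in> Pow B. real (card L) \<le> \<eta> * real (card B)}) \<le> a powr (2 * real (card B))"
proof
  \<comment> \<open>\<open>x\<close> gives \<open>1 + x \<le> a\<close> and \<open>\<eta>\<close>
    gives \<open>x powr (- \<eta>) \<le> a\<close>, one factor each. The summand 1 in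
    \<open>1 - ln x\<close> avoids a zero denominator at \<open>x = 1\<close>; the cap 1/4 ensures
    that pruning removes at least 3/4 of \<open>card B\<close> from the mass.\<close>
  define x where "x = min 1 (a - 1)"
  define \<eta> where "\<eta> = min (1/4) (ln a / (1 - ln x))"
  have x: "0 < x" "x \<le> 1" "1 + x \<le> a" using a by (auto simp: x_def)
  have lnx: "ln x \<le> 0" using x by simp
  have lna: "0 < ln a" using a by simp
  show \<eta>: "0 < \<eta>" "\<eta> \<le> 1/4" using lnx lna unfolding \<eta>_def by (simp, linarith)
  have "\<eta> * (1 - ln x) \<le> ln a"
    using lnx pos_le_divide_eq[of "1 - ln x" \<eta> "ln a"] by (simp add: \<eta>_def)
  moreover have "\<eta> * (1 - ln x) = \<eta> - \<eta> * ln x" by (simp add: algebra_simps)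
  ultimately have "- \<eta> * ln x \<le> ln a" using \<eta> by simp
  then have "exp (- \<eta> * ln x) \<le> exp (ln a)" by (simp only: exp_le_cancel_iff)
  then have xa: "x powr (- \<eta>) \<le> a"
    using x a by (simp add: powr_def)
  fix B :: "'a set" assume B: "finite B"
  let ?F = "{L \<in> Pow B. real (card L) \<le> \<eta> * real (card B)}"
  have "real (card ?F) = (\<Sum>L\<in>?F. 1)" by simp
  also have "\<dots> \<le> (\<Sum>L\<in>?F. x powr (- \<eta> * real (card B)) * x ^ card L)"
  proof (rule sum_mono)
    fix L assume "L \<in> ?F"
    then have "x powr 0 \<le> x powr (real (card L) - \<eta> * real (card B))"
      using x by (intro powr_mono') auto
    then show "1 \<le> x powr (- \<eta> * real (card B)) * x ^ card L"
      using x by (simp add: powr_realpow[symmetric] flip: powr_add)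
  qed
  also have "\<dots> \<le> (\<Sum>L\<in>Pow B. x powr (- \<eta> * real (card B)) * x ^ card L)"
    using B x by (intro sum_mono2) auto
  also have "\<dots> = (x powr (- \<eta>)) powr real (card B) * (1 + x) powr real (card B)"
    using x by (simp add: sum_power_card_Pow[OF B] sum_distrib_left[symmetric] powr_powr powr_realpow)
  also have "\<dots> \<le> a powr real (card B) * a powr real (card B)"
    using x xa by (intro mult_mono powr_mono2) auto
  also have "\<dots> = a powr (2 * real (card B))" by (simp flip: powr_add)
  finally show "real (card ?F) \<le> a powr (2 * real (card B))" .
qed

text \<open>Serves both as induction measure of the pruning and as exponent in the bound on the
  number of containers.\<close>

definition mass :: "nat \<Rightarrow> template \<Rightarrow> nat" where
  "mass n t = (\<Sum>e\<in>edges n. card (t e))"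

definition prune :: "nat \<Rightarrow> template \<Rightarrow> nat set set \<Rightarrow> nat \<Rightarrow> template" where
  "prune n t B \<sigma> = restrict (\<lambda>e. if e \<in> B then t e - {\<sigma>} else t e) (edges n)"

lemma mass_prune:
  assumes "\<And>e. e \<in> edges n \<Longrightarrow> finite (t e)" "B \<subseteq> edges n" "\<And>e. e \<in> B \<Longrightarrow> \<sigma> \<in> t e"
  shows "mass n (prune n t B \<sigma>) + card B = mass n t"
proof -
  have "mass n (prune n t B \<sigma>) + (\<Sum>e\<in>edges n. if e \<in> B then 1 else 0) = mass n t"
    unfolding mass_def sum.distrib[symmetric]
  proof (rule sum.cong[OF refl])
    fix e assume e: "e \<in> edges n"
    have "card (t e - {\<sigma>}) + 1 = card (t e)" if "e \<in> B"
      using card_Suc_Diff1[OF assms(1)[OF e] assms(3)[OF that]] by simp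
    then show "card (prune n t B \<sigma> e) + (if e \<in> B then 1 else 0) = card (t e)"
      using e by (simp add: prune_def)
  qed
  moreover have "(\<Sum>e\<in>edges n. if e \<in> B then 1 else 0) = card B"
    using assms(2) by (simp add: sum.If_cases Int_absorb1)
  ultimately show ?thesis by simp
qed

text \<open>The bound on the number of containers can be exponential in the mass with a base arbitrarily
  close to 1: listing the at most \<open>\<eta>|B|\<close> elements of \<open>B\<close> that keep their colour is much cheaper
  than the mass gained by pruning the others.\<close>

lemma containers_by_pruning:
  fixes a \<beta> \<eta> :: real
  assumes \<Sigma>: "finite \<Sigma>"
    and a: "1 < a" and \<beta>: "0 < \<beta>" and \<eta>: "\<eta> \<le> 1/4"
    and small: "\<And>B :: nat set set. finite B \<Longrightarrow>
      real (card {L \<in> Pow B. real (card L) \<le> \<eta> * real (card B)}) \<le> a powr (2 * real (card B))"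
    and step: "\<And>t. t \<in> templates \<Sigma> n \<Longrightarrow> \<not> good t \<Longrightarrow> \<exists>F. finite F \<and> real (card F) \<le> a powr \<beta> \<and>
      (\<forall>c \<in> C \<inter> realisations n t. \<exists>(B, \<sigma>)\<in>F. B \<subseteq> edges n \<and> (\<forall>x\<in>B. \<sigma> \<in> t x) \<and> \<beta> \<le> real (card B) \<and>
        real (card {x \<in> B. c x = \<sigma>}) \<le> \<eta> * real (card B))"
    and t: "t \<in> templates \<Sigma> n"
  shows "\<exists>T. T \<subseteq> templates \<Sigma> n \<and> finite T \<and> (\<forall>c \<in> C \<inter> realisations n t. \<exists>t'\<in>T. c \<in> realisations n t') \<and>
    (\<forall>t'\<in>T. good t') \<and> real (card T) \<le> a powr (4 * real (mass n t))"
  using t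
proof (induction "mass n t" arbitrary: t rule: less_induct)
  case less
  show ?case
  proof (cases "good t")
    case True
    have "1 \<le> a powr (4 * real (mass n t))" using a by (intro ge_one_powr_ge_zero) auto
    then show ?thesis
      using True less.prems by (intro exI[of _ "{t}"]) auto
  next
    case False
    have fin_t: "finite (t e)" if "e \<in> edges n" for e
    proof -
      have "t e \<in> Pow \<Sigma> - {{}}" using less.prems that unfolding templates_def by (rule PiE_mem)
      then show ?thesis using \<Sigma> finite_subset by auto
    qed
    obtain F where F: "finite F" "real (card F) \<le> a powr \<beta>"
      and cover: "\<And>c. c \<in> C \<Longrightarrow> c \<in> realisations n t \<Longrightarrow> \<exists>(B, \<sigma>)\<in>F. B \<subseteq> edges n \<and> (\<forall>x\<in>B. \<sigma> \<in> t x) \<and>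
        \<beta> \<le> real (card B) \<and> real (card {x \<in> B. c x = \<sigma>}) \<le> \<eta> * real (card B)"
      using step[OF less.prems False] by blast
    \<comment> \<open>Pairs that fail these conditions cover no colouring and would spoil the
      decrease of the mass.\<close>
    define F' where "F' = {(B, \<sigma>) \<in> F. B \<subseteq> edges n \<and> (\<forall>x\<in>B. \<sigma> \<in> t x) \<and> \<beta> \<le> real (card B)}"
    define S where "S = (\<lambda>p :: nat set set \<times> nat. {L \<in> Pow (fst p). real (card L) \<le> \<eta> * real (card (fst p))})"
    define pr where "pr = (\<lambda>p L. prune n t (fst p - L) (snd p))"
    \<comment> \<open>Branches that empty some \<open>t e\<close> are dropped; a branch with a
      realisation is never among them.\<close>
    define I where "I = {(p, L) \<in> Sigma F' S. pr p L \<in> templates \<Sigma> n}"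
    have "F' \<subseteq> F" by (auto simp: F'_def)
    then have finF': "finite F'" "card F' \<le> card F"
      using F(1) by (auto intro: card_mono finite_subset)
    have F': "finite (fst p)" if "p \<in> F'" for p
      using that finite_subset[OF _ finite_edges[of n]] by (auto simp: F'_def)
    have finS: "finite (S p)" if "p \<in> F'" for p
      using F'[OF that] by (simp add: S_def)
    have finI: "finite I"
      using finite_SigmaI[OF finF'(1) finS] unfolding I_def by (rule rev_finite_subset) auto
    have mass: "real (mass n (pr p L)) \<le> real (mass n t) - 3/4 * real (card (fst p))"
      "mass n (pr p L) < mass n t" if "p \<in> F'" "L \<in> S p" for p L
    proof -
      have L: "L \<subseteq> fst p" "real (card L) \<le> \<eta> * real (card (fst p))"
        and p: "fst p \<subseteq> edges n" "\<forall>x\<in>fst p. snd p \<in> t x" "\<beta> \<le> real (card (fst p))"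
        using that by (auto simp: S_def F'_def)
      have fp: "finite (fst p)" by (rule finite_subset[OF p(1) finite_edges])
      have "mass n (pr p L) + card (fst p - L) = mass n t"
        unfolding pr_def using p L by (intro mass_prune fin_t) auto
      moreover have "real (card (fst p - L)) = real (card (fst p)) - real (card L)"
        using L fp finite_subset[OF L(1) fp] card_mono[OF fp L(1)] by (simp add: card_Diff_subset)
      moreover have "real (card L) \<le> 1/4 * real (card (fst p))"
        using L(2) mult_right_mono[OF \<eta>, of "real (card (fst p))"] by linarith
      ultimately show "real (mass n (pr p L)) \<le> real (mass n t) - 3/4 * real (card (fst p))"
        "mass n (pr p L) < mass n t"
        using p(3) \<beta> by linarith+
    qed
    have "\<forall>i\<in>I. \<exists>T. T \<subseteq> templates \<Sigma> n \<and> finite T \<and>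
        (\<forall>c \<in> C \<inter> realisations n (pr (fst i) (snd i)). \<exists>t'\<in>T. c \<in> realisations n t') \<and>
        (\<forall>t'\<in>T. good t') \<and> real (card T) \<le> a powr (4 * real (mass n (pr (fst i) (snd i))))"
    proof
      fix i assume "i \<in> I"
      then show "\<exists>T. T \<subseteq> templates \<Sigma> n \<and> finite T \<and>
        (\<forall>c \<in> C \<inter> realisations n (pr (fst i) (snd i)). \<exists>t'\<in>T. c \<in> realisations n t') \<and>
        (\<forall>t'\<in>T. good t') \<and> real (card T) \<le> a powr (4 * real (mass n (pr (fst i) (snd i))))"
        using mass(2) by (intro less.hyps) (auto simp: I_def)
    qed
    from bchoice[OF this] obtain U where U: "\<forall>i\<in>I. U i \<subseteq> templates \<Sigma> n \<and> finite (U i) \<and>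
        (\<forall>c \<in> C \<inter> realisations n (pr (fst i) (snd i)). \<exists>t'\<in>U i. c \<in> realisations n t') \<and>
        (\<forall>t'\<in>U i. good t') \<and> real (card (U i)) \<le> a powr (4 * real (mass n (pr (fst i) (snd i))))"
      by blast
    define W where "W = a powr (4 * real (mass n t))"
    have "\<exists>t'\<in>\<Union>(U ` I). c \<in> realisations n t'" if c: "c \<in> C" "c \<in> realisations n t" for c
    proof -
      obtain B \<sigma> where B: "(B, \<sigma>) \<in> F" "B \<subseteq> edges n" "\<forall>x\<in>B. \<sigma> \<in> t x"
        "\<beta> \<le> real (card B)" "real (card {x \<in> B. c x = \<sigma>}) \<le> \<eta> * real (card B)"
        using cover[OF c] by blast
      \<comment> \<open>Within \<open>B\<close>, the colour \<open>\<sigma>\<close> is kept exactly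
        where \<open>c\<close> uses it, so \<open>c\<close> still realises the pruned
        template.\<close>
      define L where "L = {x \<in> B. c x = \<sigma>}"
      have ce: "c e \<in> pr (B, \<sigma>) L e" if "e \<in> edges n" for e
      proof -
        have "c e \<in> t e" using c(2) that unfolding realisations_def by (rule PiE_mem)
        then show ?thesis using that by (auto simp: pr_def prune_def L_def)
      qed
      have c': "c \<in> realisations n (pr (B, \<sigma>) L)"
        using c(2) ce unfolding realisations_def PiE_def Pi_def by blast
      have "pr (B, \<sigma>) L \<in> templates \<Sigma> n"
        unfolding templates_def
      proof (rule PiE_I)
        fix e assume e: "e \<in> edges n"
        have "t e \<in> Pow \<Sigma> - {{}}" using less.prems e unfolding templates_def by (rule PiE_mem)
        moreover have "pr (B, \<sigma>) L e \<subseteq> t e" using e by (auto simp: pr_def prune_def)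
        ultimately show "pr (B, \<sigma>) L e \<in> Pow \<Sigma> - {{}}" using ce[OF e] by blast
      qed (simp add: pr_def prune_def)
      then have "((B, \<sigma>), L) \<in> I"
        using B by (auto simp: I_def F'_def S_def L_def)
      then show ?thesis using U c(1) c' by fastforce
    qed
    moreover have "real (card (\<Union>(U ` I))) \<le> W"
    proof -
      have "real (card (\<Union>(U ` I))) \<le> real (\<Sum>i\<in>I. card (U i))"
        using card_UN_le[OF finI, of U] by (simp only: of_nat_le_iff)
      \<comment> \<open>A branch loses at least 3/4 of \<open>card B\<close> in mass, so the
        induction bound with exponent \<open>4 * mass\<close> gains a factor
        \<open>a powr (- 3 * card B)\<close>.\<close>
      also have "\<dots> \<le> (\<Sum>i\<in>I. W * a powr (- 3 * real (card (fst (fst i)))))"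
        unfolding of_nat_sum
      proof (rule sum_mono)
        fix i assume i: "i \<in> I"
        have "4 * real (mass n (pr (fst i) (snd i))) \<le> 4 * real (mass n t) + - 3 * real (card (fst (fst i)))"
          using mass(1)[of "fst i" "snd i"] i by (auto simp: I_def)
        then have "a powr (4 * real (mass n (pr (fst i) (snd i)))) \<le>
            a powr (4 * real (mass n t) + - 3 * real (card (fst (fst i))))"
          using a by (intro powr_mono) auto
        then show "real (card (U i)) \<le> W * a powr (- 3 * real (card (fst (fst i))))"
          using U i unfolding W_def powr_add by (meson order_trans)
      qed
      also have "\<dots> \<le> (\<Sum>i\<in>Sigma F' S. W * a powr (- 3 * real (card (fst (fst i)))))"
        using finite_SigmaI[OF finF'(1) finS] by (intro sum_mono2) (auto simp: I_def W_def)
      also have "\<dots> = (\<Sum>p\<in>F'. real (card (S p)) * (W * a powr (- 3 * real (card (fst p)))))"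
        using finF'(1) finS by (subst sum.Sigma[symmetric, of F' S "\<lambda>p L. W * a powr (- 3 * real (card (fst p)))", unfolded case_prod_beta]) auto
      \<comment> \<open>After the at most \<open>a powr (2 * card B)\<close> choices of
        \<open>L\<close>, a gain of \<open>a powr (- card B) \<le> a powr (- \<beta>)\<close> is
        left. It absorbs the at most \<open>a powr \<beta>\<close> pairs.\<close>
      also have "\<dots> \<le> (\<Sum>p\<in>F'. W * a powr (- \<beta>))"
      proof (rule sum_mono)
        fix p assume p: "p \<in> F'"
        have \<beta>p: "\<beta> \<le> real (card (fst p))" using p by (auto simp: F'_def)
        have "real (card (S p)) * (W * a powr (- 3 * real (card (fst p)))) \<le>
            a powr (2 * real (card (fst p))) * (W * a powr (- 3 * real (card (fst p))))"
          using small[OF F'[OF p]] by (intro mult_right_mono) (auto simp: S_def W_def)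
        also have "\<dots> = W * a powr (- real (card (fst p)))"
          by (simp flip: powr_add)
        also have "\<dots> \<le> W * a powr (- \<beta>)"
          using a \<beta>p by (intro mult_left_mono powr_mono) (auto simp: W_def)
        finally show "real (card (S p)) * (W * a powr (- 3 * real (card (fst p)))) \<le> W * a powr (- \<beta>)" .
      qed
      also have "\<dots> = real (card F') * (W * a powr (- \<beta>))" by simp
      also have "\<dots> \<le> a powr \<beta> * (W * a powr (- \<beta>))"
        using F(2) finF'(2) by (intro mult_right_mono) (auto simp: W_def)
      also have "\<dots> = W"
        using a by (simp add: powr_minus field_simps)
      finally show ?thesis .
    qed
    ultimately show ?thesis
      using U finI unfolding W_def by (intro exI[of _ "\<Union>(U ` I)"]) blast
  qed
qed

section \<open>Order-hereditary properties\<close>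

lemma finite_templates: "finite \<Sigma> \<Longrightarrow> finite (templates \<Sigma> n)"
  by (simp add: templates_def finite_PiE)

lemma template_edge:
  assumes "t \<in> templates \<Sigma> n" "e \<in> edges n"
  shows "t e \<subseteq> \<Sigma>" "t e \<noteq> {}"
  using PiE_mem[OF assms[unfolded templates_def]] by auto

lemma finite_realisations:
  assumes "finite \<Sigma>" "t \<in> templates \<Sigma> n"
  shows "finite (realisations n t)"
  unfolding realisations_def
  by (intro finite_PiE finite_edges finite_subset[OF template_edge(1)[OF assms(2)] assms(1)])

lemma realisations_subset:
  assumes "t \<in> templates \<Sigma> n"
  shows "realisations n t \<subseteq> edges n \<rightarrow>\<^sub>E \<Sigma>"
  unfolding realisations_def by (intro PiE_mono template_edge(1)[OF assms])

text \<open>Closure is asked along increasing enumerations, since a relabelling that reverses a pair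
  exchanges the digraph colours 2 and 3. Two colours make the base of the logarithms exceed 1;
  nonemptiness makes \<open>extremal\<close> a maximum over a nonempty set.\<close>

locale order_hereditary =
  fixes \<Sigma> :: "nat set" and Q :: "nat \<Rightarrow> colouring set"
  assumes finite_\<Sigma>: "finite \<Sigma>"
    and card_\<Sigma>: "2 \<le> card \<Sigma>"
    and colourings: "Q n \<subseteq> edges n \<rightarrow>\<^sub>E \<Sigma>"
    and nonempty: "Q n \<noteq> {}"
    and restr_closed: "c \<in> Q n \<Longrightarrow> A \<subseteq> {1..n} \<Longrightarrow> restr c A \<in> Q (card A)"
begin

text \<open>Counting sets instead of pairs of a set and a colouring suits double counting over
  subsets; the passage to pairs costs a factor independent of \<open>n\<close>, see
  \<open>card_bad_pairs\<close>.\<close>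

definition bad_sets :: "nat \<Rightarrow> nat \<Rightarrow> template \<Rightarrow> nat set set" where
  "bad_sets n m t = {A \<in> nsets {1..n} m. \<exists>c\<in>realisations n t. restr c A \<notin> Q m}"

lemma finite_bad_sets [simp]: "finite (bad_sets n m t)"
  by (simp add: bad_sets_def finite_imp_finite_nsets)

lemma log_card_bounds:
  assumes "t \<in> templates \<Sigma> n" "e \<in> edges n"
  shows "0 \<le> log (real (card \<Sigma>)) (real (card (t e)))"
    and "log (real (card \<Sigma>)) (real (card (t e))) \<le> 1"
    and "0 < card (t e)"
proof -
  have "finite (t e)" using template_edge(1)[OF assms] finite_\<Sigma> finite_subset by blast
  then show pos: "0 < card (t e)"
    using template_edge(2)[OF assms] by (simp add: card_gt_0_iff)
  have "card (t e) \<le> card \<Sigma>"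
    using template_edge(1)[OF assms] finite_\<Sigma> by (rule card_mono[rotated])
  then show "0 \<le> log (real (card \<Sigma>)) (real (card (t e)))"
    "log (real (card \<Sigma>)) (real (card (t e))) \<le> 1"
    using pos card_\<Sigma> by (auto simp: zero_le_log_cancel_iff log_le_one_cancel_iff)
qed

lemma Ent_nonneg: "t \<in> templates \<Sigma> n \<Longrightarrow> 0 \<le> Ent \<Sigma> n t"
  unfolding Ent_def by (intro sum_nonneg log_card_bounds(1))

lemma Ent_le: "t \<in> templates \<Sigma> n \<Longrightarrow> Ent \<Sigma> n t \<le> real (n choose 2)"
  unfolding Ent_def
  using sum_bounded_above[of "edges n" "\<lambda>e. log (real (card \<Sigma>)) (real (card (t e)))" 1] log_card_bounds(2)
  by (simp add: card_edges)

lemma card_realisations: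
  assumes t: "t \<in> templates \<Sigma> n"
  shows "real (card (realisations n t)) = real (card \<Sigma>) powr Ent \<Sigma> n t"
proof -
  have "real (card (realisations n t)) = (\<Prod>e\<in>edges n. real (card (t e)))"
    by (simp add: realisations_def card_PiE)
  also have "\<dots> = (\<Prod>e\<in>edges n. real (card \<Sigma>) powr log (real (card \<Sigma>)) (real (card (t e))))"
    using log_card_bounds(3)[OF t] card_\<Sigma> by (intro prod.cong[OF refl]) simp
  also have "\<dots> = real (card \<Sigma>) powr Ent \<Sigma> n t"
    using card_\<Sigma> unfolding Ent_def by (subst powr_sum) auto
  finally show ?thesis .
qed

section \<open>Extremal entropy and its limiting density\<close>

lemma finite_extremal_set: "finite {Ent \<Sigma> n t | t. t \<in> templates \<Sigma> n \<and> realisations n t \<subseteq> Q n}"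
  by (rule finite_subset[of _ "Ent \<Sigma> n ` templates \<Sigma> n"]) (auto simp: finite_templates finite_\<Sigma>)

lemma Ent_le_extremal:
  assumes "t \<in> templates \<Sigma> n" "realisations n t \<subseteq> Q n"
  shows "Ent \<Sigma> n t \<le> extremal \<Sigma> Q n"
  unfolding extremal_def using finite_extremal_set by (intro Max_ge) (use assms in blast)+

lemma extremal_attained:
  obtains t where "t \<in> templates \<Sigma> n" "realisations n t \<subseteq> Q n" "Ent \<Sigma> n t = extremal \<Sigma> Q n"
proof -
  obtain c where c: "c \<in> Q n" using nonempty by blast
  then have cE: "c \<in> edges n \<rightarrow>\<^sub>E \<Sigma>" using colourings by blast
  \<comment> \<open>The template that allows only the colours of \<open>c\<close> is realised by
    \<open>c\<close> alone, which shows that the maximum in \<open>extremal\<close> ranges over a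
    nonempty set.\<close>
  define t where "t = restrict (\<lambda>e. {c e}) (edges n)"
  have "t \<in> templates \<Sigma> n" using cE by (auto simp: t_def templates_def)
  moreover have "realisations n t \<subseteq> {c}"
  proof
    fix d assume d: "d \<in> realisations n t"
    have "d = c"
    proof (rule PiE_ext)
      show "d \<in> edges n \<rightarrow>\<^sub>E UNIV" "c \<in> edges n \<rightarrow>\<^sub>E UNIV"
        using d cE unfolding realisations_def by blast+
      show "d e = c e" if "e \<in> edges n" for e
        using PiE_mem[OF d[unfolded realisations_def] that] that by (simp add: t_def)
    qed
    then show "d \<in> {c}" by simp
  qed
  ultimately have "{Ent \<Sigma> n t | t. t \<in> templates \<Sigma> n \<and> realisations n t \<subseteq> Q n} \<noteq> {}"
    using c by blast
  from Max_in[OF finite_extremal_set this]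
  obtain t where "t \<in> templates \<Sigma> n" "realisations n t \<subseteq> Q n" "extremal \<Sigma> Q n = Ent \<Sigma> n t"
    unfolding extremal_def by (auto simp only: mem_Collect_eq)
  then show thesis using that by simp
qed

lemma extremal_nonneg: "0 \<le> extremal \<Sigma> Q n"
  by (metis Ent_nonneg extremal_attained)

text \<open>Double counting: each edge lies in \<open>(n - 2) choose (N - 2)\<close> of the
  \<open>N\<close>-sets.\<close>

lemma sum_Ent_restr:
  assumes n: "2 \<le> N" "N \<le> n"
  shows "(\<Sum>A\<in>nsets {1..n} N. Ent \<Sigma> N (restr t A)) = real ((n - 2) choose (N - 2)) * Ent \<Sigma> n t"
proof -
  let ?w = "\<lambda>e. log (real (card \<Sigma>)) (real (card (t e)))"
  have "(\<Sum>A\<in>nsets {1..n} N. Ent \<Sigma> N (restr t A)) =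
      (\<Sum>A\<in>nsets {1..n} N. \<Sum>e | e \<in> edges n \<and> e \<subseteq> A. ?w e)"
    by (intro sum.cong[OF refl]) (auto simp: nsets_def Ent_restr[symmetric])
  also have "\<dots> = (\<Sum>e\<in>edges n. \<Sum>A | A \<in> nsets {1..n} N \<and> e \<subseteq> A. ?w e)"
    by (intro sum.swap_restrict) (auto simp: finite_imp_finite_nsets)
  also have "\<dots> = (\<Sum>e\<in>edges n. real ((n - 2) choose (N - 2)) * ?w e)"
  proof (rule sum.cong[OF refl])
    fix e assume "e \<in> edges n"
    then have "card {A \<in> nsets {1..n} N. e \<subseteq> A} = (n - 2) choose (N - 2)"
      using n by (intro card_supersets) (auto simp: edges_iff)
    then show "(\<Sum>A | A \<in> nsets {1..n} N \<and> e \<subseteq> A. ?w e) = real ((n - 2) choose (N - 2)) * ?w e"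
      by (simp only: sum_constant)
  qed
  finally show ?thesis by (simp add: Ent_def sum_distrib_left)
qed

text \<open>Averaging over \<open>N\<close>-sets: on a set that is not bad, all realisations of the
  restricted template lie in \<open>Q N\<close>, so its entropy is at most
  \<open>extremal \<Sigma> Q N\<close>; on a bad set the trivial bound \<open>N choose 2\<close> is
  used.\<close>

lemma Ent_supersaturation:
  assumes n: "2 \<le> N" "N \<le> n" and t: "t \<in> templates \<Sigma> n"
  shows "Ent \<Sigma> n t \<le>
    (extremal \<Sigma> Q N / real (N choose 2) + real (card (bad_sets n N t)) / real (n choose N)) * real (n choose 2)"
proof -
  have pos: "0 < real (N choose 2)" "0 < real (n choose N)" using n by (simp_all add: zero_less_binomial)
  \<comment> \<open>Expresses the number of \<open>N\<close>-sets through an edge as the fraction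
    \<open>(N choose 2) / (n choose 2)\<close> of all \<open>N\<close>-sets.\<close>
  have "(n choose N) * (N choose 2) = (n choose 2) * ((n - 2) choose (N - 2))"
    using n by (intro choose_mult)
  then have id: "real (n choose N) * real (N choose 2) = real (n choose 2) * real ((n - 2) choose (N - 2))"
    by (metis of_nat_mult)
  have "real ((n - 2) choose (N - 2)) * Ent \<Sigma> n t = (\<Sum>A\<in>nsets {1..n} N. Ent \<Sigma> N (restr t A))"
    using sum_Ent_restr[OF n] by simp
  also have "\<dots> \<le> (\<Sum>A\<in>nsets {1..n} N. extremal \<Sigma> Q N + (if A \<in> bad_sets n N t then real (N choose 2) else 0))"
  proof (rule sum_mono)
    fix A assume A: "A \<in> nsets {1..n} N"
    then have A': "A \<subseteq> {1..n}" "card A = N" by (auto simp: nsets_def)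
    have tA: "restr t A \<in> templates \<Sigma> N" using restr_template[OF t A'(1)] A'(2) by simp
    show "Ent \<Sigma> N (restr t A) \<le> extremal \<Sigma> Q N + (if A \<in> bad_sets n N t then real (N choose 2) else 0)"
    proof (cases "A \<in> bad_sets n N t")
      case True
      then show ?thesis using Ent_le[OF tA] extremal_nonneg[of N] by simp
    next
      case False
      have "realisations N (restr t A) \<subseteq> Q N"
      proof
        fix c assume "c \<in> realisations N (restr t A)"
        then obtain c' where "c' \<in> realisations n t" "restr c' A = c"
          using realisation_extend[OF t A'(1)] A'(2) by metis
        then show "c \<in> Q N" using False A by (auto simp: bad_sets_def)
      qed
      then show ?thesis using Ent_le_extremal[OF tA] False by simp
    qed
  qed
  also have "\<dots> = real (n choose N) * extremal \<Sigma> Q N + real (card (bad_sets n N t)) * real (N choose 2)"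
  proof -
    have "nsets {1..n} N \<inter> {A. A \<in> bad_sets n N t} = bad_sets n N t" by (auto simp: bad_sets_def)
    then show ?thesis
      by (simp add: sum.distrib sum.If_cases finite_imp_finite_nsets card_nsets)
  qed
  finally have *: "real ((n - 2) choose (N - 2)) * Ent \<Sigma> n t \<le>
    real (n choose N) * extremal \<Sigma> Q N + real (card (bad_sets n N t)) * real (N choose 2)" .
  have "real (n choose N) * real (N choose 2) * Ent \<Sigma> n t =
      real (n choose 2) * (real ((n - 2) choose (N - 2)) * Ent \<Sigma> n t)"
    unfolding id by (simp only: mult.assoc)
  also have "\<dots> \<le> real (n choose 2) *
      (real (n choose N) * extremal \<Sigma> Q N + real (card (bad_sets n N t)) * real (N choose 2))"
    by (intro mult_left_mono *) simp
  finally show ?thesis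
    using pos by (simp add: field_simps)
qed

text \<open>By heredity an extremal template for \<open>n\<close> has no bad \<open>N\<close>-sets,
  so the error term of the supersaturation bound vanishes.\<close>

lemma extremal_density_antimono:
  assumes "2 \<le> N" "N \<le> n"
  shows "extremal \<Sigma> Q n / real (n choose 2) \<le> extremal \<Sigma> Q N / real (N choose 2)"
proof -
  obtain t where t: "t \<in> templates \<Sigma> n" "realisations n t \<subseteq> Q n" "Ent \<Sigma> n t = extremal \<Sigma> Q n"
    by (rule extremal_attained)
  have "bad_sets n N t = {}"
    using t(2) restr_closed by (force simp: bad_sets_def nsets_def)
  then have "extremal \<Sigma> Q n \<le> extremal \<Sigma> Q N / real (N choose 2) * real (n choose 2)"
    using Ent_supersaturation[OF assms t(1)] t(3) by simp
  moreover have "0 < real (n choose 2)" using assms by (simp add: zero_less_binomial)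
  ultimately show ?thesis by (simp add: pos_divide_le_eq)
qed

lemma entropy_density_limit:
  shows "(\<lambda>n. extremal \<Sigma> Q n / real (n choose 2)) \<longlonglongrightarrow> entropy_density \<Sigma> Q"
    and "2 \<le> n \<Longrightarrow> entropy_density \<Sigma> Q \<le> extremal \<Sigma> Q n / real (n choose 2)"
proof -
  let ?f = "\<lambda>n. extremal \<Sigma> Q n / real (n choose 2)"
  \<comment> \<open>The shift by 2 skips the indices at which the denominator is 0 and the quotient
    has the default value 0, where monotonicity may fail.\<close>
  have dec: "decseq (\<lambda>n. ?f (n + 2))"
    by (rule decseq_SucI) (simp add: extremal_density_antimono del: binomial_Suc_Suc)
  moreover have "\<forall>i. 0 \<le> ?f (i + 2)" using extremal_nonneg by simp
  ultimately obtain L where L: "(\<lambda>n. ?f (n + 2)) \<longlonglongrightarrow> L" "\<forall>i. L \<le> ?f (i + 2)"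
    by (rule decseq_convergent)
  have lim: "?f \<longlonglongrightarrow> L" using L(1) by (rule LIMSEQ_offset)
  then have eq: "entropy_density \<Sigma> Q = L" unfolding entropy_density_def by (rule limI)
  show "?f \<longlonglongrightarrow> entropy_density \<Sigma> Q" using lim eq by simp
  show "entropy_density \<Sigma> Q \<le> ?f n" if "2 \<le> n"
    using L(2)[rule_format, of "n - 2"] le_add_diff_inverse2[OF that] eq by metis
qed

lemma entropy_density_le_extremal:
  assumes "2 \<le> n"
  shows "entropy_density \<Sigma> Q * real (n choose 2) \<le> extremal \<Sigma> Q n"
proof -
  have "0 < real (n choose 2)" using assms by (simp add: zero_less_binomial)
  then show ?thesis using entropy_density_limit(2)[OF assms] by (simp add: pos_le_divide_eq)
qed

text \<open>The realisations of an extremal template alone provide this many members. The stability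
  proof measures the exceptional colourings against this bound.\<close>

lemma card_property_ge:
  assumes "2 \<le> n"
  shows "real (card \<Sigma>) powr (entropy_density \<Sigma> Q * real (n choose 2)) \<le> real (card (Q n))"
proof -
  obtain t where t: "t \<in> templates \<Sigma> n" "realisations n t \<subseteq> Q n" "Ent \<Sigma> n t = extremal \<Sigma> Q n"
    by (rule extremal_attained)
  have "finite (Q n)"
    using colourings by (rule finite_subset) (simp add: finite_PiE finite_\<Sigma>)
  have "real (card \<Sigma>) powr (entropy_density \<Sigma> Q * real (n choose 2)) \<le> real (card \<Sigma>) powr extremal \<Sigma> Q n"
    using entropy_density_le_extremal[OF assms] card_\<Sigma> by (intro powr_mono) auto
  also have "\<dots> = real (card (realisations n t))"
    using card_realisations[OF t(1)] t(3) by simp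
  also have "\<dots> \<le> real (card (Q n))"
    using card_mono[OF \<open>finite (Q n)\<close> t(2)] by simp
  finally show ?thesis .
qed

section \<open>Bad sets of different sizes, bad pairs and forbidden copies\<close>

lemma bad_superset:
  assumes "A \<in> bad_sets n m t" "A \<subseteq> B" "B \<in> nsets {1..n} N"
  shows "B \<in> bad_sets n N t"
proof -
  obtain c where c: "c \<in> realisations n t" "restr c A \<notin> Q m" and A: "A \<in> nsets {1..n} m"
    using assms(1) by (auto simp: bad_sets_def)
  have B: "finite B" "card B = N" using assms(3) by (auto simp: nsets_def)
  obtain A' where A': "A' \<subseteq> {1..card B}" "card A' = card A" "restr (restr c B) A' = restr c A"
    using restr_restr[OF B(1) assms(2)] by blast
  have "restr c B \<notin> Q N"
    using restr_closed[of "restr c B" N A'] A' B(2) c(2) A by (auto simp: nsets_def)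
  then show ?thesis using c(1) assms(3) by (auto simp: bad_sets_def)
qed

text \<open>Double counting of pairs \<open>A \<subseteq> B\<close> with \<open>A\<close> bad: every
  superset of \<open>A\<close> of size \<open>N\<close> is bad by heredity, and a bad
  \<open>B\<close> has only \<open>N choose m\<close> subsets of size \<open>m\<close>. The density
  of bad sets thus cannot drop as their size grows.\<close>

lemma card_bad_sets_mono:
  assumes "m \<le> N" "N \<le> n"
  shows "card (bad_sets n m t) * (n choose N) \<le> card (bad_sets n N t) * (n choose m)"
proof -
  have fin_B: "finite B \<and> card B = N" if "B \<in> bad_sets n N t" for B
    using that by (simp add: bad_sets_def nsets_def)
  let ?P = "Sigma (bad_sets n m t) (\<lambda>A. {B \<in> nsets {1..n} N. A \<subseteq> B})"
  have "card (bad_sets n m t) * ((n - m) choose (N - m)) = card ?P"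
  proof -
    have "card {B \<in> nsets {1..n} N. A \<subseteq> B} = (n - m) choose (N - m)" if "A \<in> bad_sets n m t" for A
      using that assms by (intro card_supersets) (auto simp: bad_sets_def nsets_def)
    then have "(\<Sum>A\<in>bad_sets n m t. card {B \<in> nsets {1..n} N. A \<subseteq> B}) =
        card (bad_sets n m t) * ((n - m) choose (N - m))"
      by simp
    then show ?thesis
      by (subst card_SigmaI) (simp_all add: finite_imp_finite_nsets)
  qed
  also have "\<dots> \<le> card (Sigma (bad_sets n N t) (\<lambda>B. nsets B m))"
  proof (rule card_inj_on_le[of prod.swap])
    show "prod.swap ` ?P \<subseteq> Sigma (bad_sets n N t) (\<lambda>B. nsets B m)"
    proof (rule image_subsetI)
      fix p assume "p \<in> ?P"
      then obtain A B where p: "p = (A, B)" and A: "A \<in> bad_sets n m t" and "B \<in> {B \<in> nsets {1..n} N. A \<subseteq> B}"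
        by (elim SigmaE) (rule that)
      then have B: "A \<subseteq> B" "B \<in> nsets {1..n} N" by simp_all
      have "A \<in> nsets B m" using A B by (simp add: bad_sets_def nsets_def)
      with bad_superset[OF A B] show "prod.swap p \<in> Sigma (bad_sets n N t) (\<lambda>B. nsets B m)"
        by (simp add: p)
    qed
    show "finite (Sigma (bad_sets n N t) (\<lambda>B. nsets B m))"
      using fin_B by (intro finite_SigmaI finite_bad_sets finite_imp_finite_nsets) blast
  qed (simp add: inj_on_def)
  also have "\<dots> = (\<Sum>B\<in>bad_sets n N t. N choose m)"
    using fin_B by (subst card_SigmaI) (auto simp: card_nsets finite_imp_finite_nsets)
  also have "\<dots> = card (bad_sets n N t) * (N choose m)" by simp
  finally have "card (bad_sets n m t) * ((n - m) choose (N - m)) * (n choose m) \<le>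
      card (bad_sets n N t) * (N choose m) * (n choose m)"
    by (rule mult_le_mono1)
  then have "card (bad_sets n m t) * ((n choose m) * ((n - m) choose (N - m))) \<le>
      card (bad_sets n N t) * (n choose m) * (N choose m)"
    by (simp only: ac_simps)
  then have "card (bad_sets n m t) * (n choose N) * (N choose m) \<le>
      card (bad_sets n N t) * (n choose m) * (N choose m)"
    unfolding choose_mult[OF assms, symmetric] by (simp only: mult.assoc)
  moreover have "0 < N choose m" using assms by (simp add: zero_less_binomial)
  ultimately show ?thesis by simp
qed

text \<open>Links \<open>bad_sets\<close> to the pairs counted in
  \<open>strong_stability_family\<close>: the set of each such pair is bad, and it occurs with at
  most \<open>card \<Sigma> ^ (m choose 2)\<close> colourings.\<close>

lemma card_bad_pairs:
  assumes t: "t \<in> templates \<Sigma> n"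
  shows "card {(A, c). A \<in> nsets {1..n} m \<and> c \<in> realisations m (restr t A) \<and> c \<notin> Q m}
    \<le> card (bad_sets n m t) * card \<Sigma> ^ (m choose 2)"
proof -
  have "{(A, c). A \<in> nsets {1..n} m \<and> c \<in> realisations m (restr t A) \<and> c \<notin> Q m} \<subseteq>
    bad_sets n m t \<times> (edges m \<rightarrow>\<^sub>E \<Sigma>)"
  proof clarify
    fix A c assume A: "A \<in> nsets {1..n} m" and c: "c \<in> realisations m (restr t A)" "c \<notin> Q m"
    then have A': "A \<subseteq> {1..n}" "card A = m" by (auto simp: nsets_def)
    then obtain c' where "c' \<in> realisations n t" "restr c' A = c"
      using realisation_extend[OF t A'(1)] c(1) by metis
    then show "A \<in> bad_sets n m t \<and> c \<in> edges m \<rightarrow>\<^sub>E \<Sigma>"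
      using A c realisations_subset[OF restr_template[OF t A'(1)]] A'(2)
      by (auto simp: bad_sets_def)
  qed
  then have "card {(A, c). A \<in> nsets {1..n} m \<and> c \<in> realisations m (restr t A) \<and> c \<notin> Q m} \<le>
    card (bad_sets n m t \<times> (edges m \<rightarrow>\<^sub>E \<Sigma>))"
    by (intro card_mono) (auto intro!: finite_PiE finite_\<Sigma>)
  then show ?thesis by (simp add: card_cartesian_product card_funcsetE card_edges)
qed

text \<open>Pigeonhole: each bad set is the image of an increasing embedding of some forbidden
  colouring of \<open>K_N\<close>, and the forbidden colouring with most copies is taken.\<close>

lemma bad_sets_copies:
  assumes t: "t \<in> templates \<Sigma> n" and bad: "bad_sets n N t \<noteq> {}"
  obtains g where "g \<in> edges N \<rightarrow>\<^sub>E \<Sigma>" "g \<notin> Q N"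
    "\<And>c. card (bad_sets n N t) \<le> card \<Sigma> ^ (N choose 2) * card (copies N n t c g {})"
proof -
  define G where "G = (edges N \<rightarrow>\<^sub>E \<Sigma>) - Q N"
  \<comment> \<open>While no edge is demanded in \<open>c\<close>, copies do not depend on
    \<open>c\<close>; hence \<open>undefined\<close> can stand for it and one \<open>g\<close>
    serves all \<open>c\<close>.\<close>
  define cp where "cp = (\<lambda>g. copies N n t undefined g {})"
  have cp: "copies N n t c g {} = cp g" for c g by (simp add: cp_def copies_def)
  have finG: "finite G" by (simp add: G_def finite_PiE finite_\<Sigma>)
  have "bad_sets n N t \<subseteq> (\<Union>g\<in>G. (\<lambda>\<phi>. \<phi> ` {1..N}) ` cp g)"
  proof
    fix A assume "A \<in> bad_sets n N t"
    then obtain c where c: "c \<in> realisations n t" "restr c A \<notin> Q N"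
      and A: "A \<subseteq> {1..n}" "finite A" "card A = N"
      by (auto simp: bad_sets_def nsets_def)
    define \<phi> where "\<phi> = restrict (elt A) {1..N}"
    have rc: "restr c A \<in> realisations N (restr t A)"
      using restr_realisation[OF c(1) A(1)] A(3) by simp
    then have g: "restr c A \<in> G"
      using c(2) realisations_subset[OF restr_template[OF t A(1)]] A(3) by (auto simp: G_def)
    have im: "\<phi> ` {1..N} = A" using elt_image[OF A(2)] A(3) by (simp add: \<phi>_def)
    have "\<phi> \<in> increasing_maps N n"
      using im A strict_mono_on_elt[OF A(2)]
      by (auto simp: increasing_maps_def \<phi>_def monotone_on_def)
    moreover have "restr c A e \<in> t (\<phi> ` e)" if e: "e \<in> edges N" for e
    proof -
      have "e \<subseteq> {1..N}" using e by (simp add: edges_iff)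
      then have "\<phi> ` e = elt A ` e" by (auto simp: \<phi>_def)
      then show ?thesis
        using PiE_mem[OF rc[unfolded realisations_def] e] e A(3) by (simp add: restr_apply)
    qed
    ultimately have "\<phi> \<in> cp (restr c A)" by (simp add: cp_def copies_def)
    then show "A \<in> (\<Union>g\<in>G. (\<lambda>\<phi>. \<phi> ` {1..N}) ` cp g)" using g im by blast
  qed
  then have "card (bad_sets n N t) \<le> card (\<Union>g\<in>G. (\<lambda>\<phi>. \<phi> ` {1..N}) ` cp g)"
    using finG by (intro card_mono) (auto simp: cp_def)
  also have "\<dots> \<le> (\<Sum>g\<in>G. card ((\<lambda>\<phi>. \<phi> ` {1..N}) ` cp g))"
    using finG by (rule card_UN_le)
  also have "\<dots> \<le> (\<Sum>g\<in>G. card (cp g))"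
    by (intro sum_mono card_image_le) (simp add: cp_def)
  finally have le: "card (bad_sets n N t) \<le> (\<Sum>g\<in>G. card (cp g))" .
  show thesis
  proof (cases "G = {}")
    case True
    then show ?thesis using le bad by simp
  next
    case False
    then have "Max ((\<lambda>g. card (cp g)) ` G) \<in> (\<lambda>g. card (cp g)) ` G"
      using finG by (intro Max_in) auto
    then obtain g where g: "g \<in> G" "Max ((\<lambda>g. card (cp g)) ` G) = card (cp g)" by blast
    have max: "card (cp h) \<le> card (cp g)" if "h \<in> G" for h
      unfolding g(2)[symmetric] using finG that by (intro Max_ge) auto
    have "(\<Sum>h\<in>G. card (cp h)) \<le> card G * card (cp g)"
      using sum_bounded_above[of G "\<lambda>h. card (cp h)" "card (cp g)"] max by simp
    also have "card G \<le> card (edges N \<rightarrow>\<^sub>E \<Sigma>)"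
      unfolding G_def by (intro card_mono) (auto intro: finite_PiE finite_\<Sigma>)
    finally have "card (bad_sets n N t) \<le> card \<Sigma> ^ (N choose 2) * card (cp g)"
      using le by (simp add: card_funcsetE card_edges)
    then show ?thesis using that[of g] g(1) cp by (simp add: G_def)
  qed
qed

end

section \<open>Containers for order-hereditary properties\<close>

text \<open>The left side is exponential in a linear function of \<open>n\<close>, the right side in
  a quadratic one.\<close>

lemma links_bound_eventually:
  fixes a \<delta> :: real and K k N :: nat
  assumes a: "1 < a" and \<delta>: "0 < \<delta>" and k: "1 \<le> k"
  shows "\<exists>n\<^sub>0. \<forall>n\<ge>n\<^sub>0. real (K * (n ^ N * k ^ (N * n))) \<le> a powr (\<delta> * real n ^ 2)"
proof -
  \<comment> \<open>The linear rate, from \<open>K \<le> exp (K * n)\<close> for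
    \<open>n \<ge> 1\<close> and \<open>n ^ N * k ^ (N * n) \<le> (2 * k) ^ (N * n)\<close>.\<close>
  define D where "D = real K + real N * ln (2 * real k)"
  have pos: "0 < \<delta> * ln a" using a \<delta> by simp
  obtain n\<^sub>0 :: nat where n\<^sub>0: "D / (\<delta> * ln a) \<le> real n\<^sub>0" using real_arch_simple by blast
  show ?thesis
  proof (intro exI[of _ "max 1 n\<^sub>0"] allI impI)
    fix n assume n: "max 1 n\<^sub>0 \<le> n"
    have k2: "0 < 2 * real k" using k by simp
    have "real (n ^ N * k ^ (N * n)) \<le> real ((2 ^ n) ^ N * k ^ (N * n))"
      using less_exp[of n] by (intro of_nat_mono mult_le_mono1 power_mono) auto
    also have "\<dots> = (2 * real k) ^ (N * n)"
      by (simp add: power_mult_distrib mult.commute flip: power_mult)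
    also have "\<dots> = exp (real (N * n) * ln (2 * real k))"
      using k2 by (simp only: exp_of_nat_mult exp_ln)
    finally have "real (n ^ N * k ^ (N * n)) \<le> exp (real (N * n) * ln (2 * real k))" .
    moreover have "real K \<le> exp (real K * real n)"
    proof -
      have "real K \<le> real K * real n" using n mult_left_mono[of 1 "real n" "real K"] by simp
      also have "\<dots> \<le> exp (real K * real n)" using exp_ge_add_one_self[of "real K * real n"] by linarith
      finally show ?thesis .
    qed
    ultimately have "real (K * (n ^ N * k ^ (N * n))) \<le>
        exp (real K * real n) * exp (real (N * n) * ln (2 * real k))"
      unfolding of_nat_mult[of K] by (intro mult_mono) auto
    also have "\<dots> = exp (D * real n)"
      by (simp add: D_def algebra_simps flip: exp_add)
    also have "\<dots> \<le> exp (\<delta> * ln a * real n * real n)"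
    proof -
      have "D / (\<delta> * ln a) \<le> real n" using n\<^sub>0 n by linarith
      then have "D \<le> \<delta> * ln a * real n" using pos by (simp add: pos_divide_le_eq mult.commute)
      then have "D * real n \<le> \<delta> * ln a * real n * real n" by (intro mult_right_mono) auto
      then show ?thesis by simp
    qed
    also have "\<dots> = a powr (\<delta> * real n ^ 2)"
      using a by (simp add: powr_def power2_eq_square ac_simps)
    finally show "real (K * (n ^ N * k ^ (N * n))) \<le> a powr (\<delta> * real n ^ 2)" .
  qed
qed

context order_hereditary
begin

text \<open>A full copy would exhibit the forbidden \<open>g\<close> as a restriction of
  \<open>c\<close>, against heredity.\<close>

lemma no_full_copy:
  assumes "c \<in> Q n" "g \<in> edges N \<rightarrow>\<^sub>E \<Sigma>" "g \<notin> Q N"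
  shows "copies N n t c g (edges N) = {}"
proof (rule ccontr)
  assume "copies N n t c g (edges N) \<noteq> {}"
  then obtain \<phi> where \<phi>: "\<phi> \<in> increasing_maps N n" "\<forall>e\<in>edges N. c (\<phi> ` e) = g e"
    by (auto simp: copies_def)
  have mono: "strict_mono_on {1..N} \<phi>" and im: "\<phi> ` {1..N} \<subseteq> {1..n}"
    using \<phi>(1) unfolding increasing_maps_def PiE_def Pi_def by blast+
  have "restr c (\<phi> ` {1..N}) = restrict (\<lambda>e. c (\<phi> ` e)) (edges N)"
    by (rule restr_image[OF mono])
  also have "\<dots> = restrict g (edges N)" using \<phi>(2) by (intro restrict_ext) blast
  also have "\<dots> = g" by (rule PiE_restrict[OF assms(2)])
  finally have "g \<in> Q N"
    using restr_closed[OF assms(1) im] card_image_strict_mono[OF mono] by simp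
  then show False using assms(3) by contradiction
qed

text \<open>Pruning starts from the template that allows all colours everywhere, which every member
  of \<open>Q n\<close> realises, and stops at templates with few bad sets.\<close>

lemma containers_with_few_bad_sets:
  fixes \<gamma> \<epsilon> :: real
  assumes N: "1 \<le> N" and \<gamma>: "0 < \<gamma>" and \<epsilon>: "0 < \<epsilon>"
  shows "\<exists>n\<^sub>0. \<forall>n\<ge>n\<^sub>0. \<exists>T. T \<subseteq> templates \<Sigma> n \<and> Q n \<subseteq> (\<Union>t\<in>T. realisations n t) \<and>
    (\<forall>t\<in>T. real (card (bad_sets n N t)) \<le> \<gamma> * real (n choose N)) \<and>
    real (card T) \<le> real (card \<Sigma>) powr (\<epsilon> * real (n choose 2))"
proof -
  define k where "k = real (card \<Sigma>)"
  have k: "2 \<le> k" using card_\<Sigma> by (simp add: k_def)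
  define r where "r = N choose 2"
  \<comment> \<open>The starting template has mass \<open>k * (n choose 2)\<close>, so
    \<open>a powr (4 * mass)\<close> becomes exactly
    \<open>k powr (\<epsilon> * (n choose 2))\<close>.\<close>
  define a where "a = k powr (\<epsilon> / (4 * k))"
  have a: "1 < a" using k \<epsilon> by (simp add: a_def)
  obtain \<eta> where \<eta>: "0 < \<eta>" "\<eta> \<le> 1/4"
    and small: "\<And>B :: nat set set. finite B \<Longrightarrow>
      real (card {L \<in> Pow B. real (card L) \<le> \<eta> * real (card B)}) \<le> a powr (2 * real (card B))"
    using few_small_subsets[OF a] by blast
  \<comment> \<open>By \<open>n choose N \<ge> (n / N) ^ N\<close> and the pigeonhole factor
    \<open>k ^ r\<close>, more than \<open>\<gamma> * (n choose N)\<close> bad sets yield at least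
    \<open>\<gamma>' * n ^ N\<close> copies of one forbidden colouring.\<close>
  define \<gamma>' where "\<gamma>' = \<gamma> / real N ^ N / k ^ r"
  have \<gamma>': "0 < \<gamma>'" using \<gamma> N k by (simp add: \<gamma>'_def)
  \<comment> \<open>\<open>\<delta> * n ^ 2\<close> is the link size guaranteed by
    \<open>sparse_link_exists\<close>; it acts as \<open>\<beta>\<close> in the pruning.\<close>
  define \<delta> where "\<delta> = (\<eta> / 2) ^ r * \<gamma>' / 2"
  have \<delta>: "0 < \<delta>" using \<eta> \<gamma>' by (simp add: \<delta>_def)
  define K where "K = card \<Sigma> ^ r * 2 ^ r * r"
  obtain n\<^sub>0 where n\<^sub>0: "\<And>n. n \<ge> n\<^sub>0 \<Longrightarrow> real (K * (n ^ N * card \<Sigma> ^ (N * n))) \<le> a powr (\<delta> * real n ^ 2)"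
    using links_bound_eventually[OF a \<delta>, of "card \<Sigma>" K N] card_\<Sigma> by auto
  show ?thesis
  proof (intro exI[of _ "max N n\<^sub>0"] allI impI)
    fix n assume n: "max N n\<^sub>0 \<le> n"
    then have n_pos: "0 < n" and nN: "N \<le> n" using N by auto
    define full where "full = restrict (\<lambda>e. \<Sigma>) (edges n)"
    have "\<Sigma> \<noteq> {}" using card_\<Sigma> by auto
    then have full: "full \<in> templates \<Sigma> n" by (simp add: full_def templates_def)
    have Q_full: "Q n \<subseteq> realisations n full"
    proof -
      have "realisations n full = edges n \<rightarrow>\<^sub>E \<Sigma>"
        unfolding realisations_def by (intro PiE_cong) (simp add: full_def)
      then show ?thesis using colourings by simp
    qed
    define good where "good = (\<lambda>t. real (card (bad_sets n N t)) \<le> \<gamma> * real (n choose N))"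
    have "\<exists>T. T \<subseteq> templates \<Sigma> n \<and> finite T \<and> (\<forall>c \<in> Q n \<inter> realisations n full. \<exists>t'\<in>T. c \<in> realisations n t') \<and>
      (\<forall>t'\<in>T. good t') \<and> real (card T) \<le> a powr (4 * real (mass n full))"
    proof (rule containers_by_pruning[OF finite_\<Sigma> a _ \<eta>(2) small])
      show "0 < \<delta> * real n ^ 2" using \<delta> n_pos by simp
      fix t assume t: "t \<in> templates \<Sigma> n" and "\<not> good t"
      then have bad: "\<gamma> * real (n choose N) < real (card (bad_sets n N t))" by (simp add: good_def)
      then have "bad_sets n N t \<noteq> {}" using \<gamma> by (auto simp: mult_less_0_iff)
      then obtain g where g: "g \<in> edges N \<rightarrow>\<^sub>E \<Sigma>" "g \<notin> Q N"
        and le: "\<And>c. card (bad_sets n N t) \<le> card \<Sigma> ^ r * card (copies N n t c g {})"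
        using bad_sets_copies[OF t] unfolding r_def by blast
      have many: "\<gamma>' * real n ^ N \<le> real (card (copies N n t c g {}))" for c
      proof -
        have "(real n / real N) ^ N \<le> real (n choose N)"
          using binomial_ge_n_over_k_pow_k[OF nN, where 'a = real] by simp
        then have "\<gamma> * (real n / real N) ^ N \<le> \<gamma> * real (n choose N)"
          using \<gamma> by (intro mult_left_mono) auto
        also have "\<dots> \<le> real (card (bad_sets n N t))" using bad by simp
        also have "\<dots> \<le> real (card \<Sigma> ^ r * card (copies N n t c g {}))"
          using le by (intro of_nat_mono)
        also have "\<dots> = k ^ r * real (card (copies N n t c g {}))" by (simp add: k_def)
        finally have "\<gamma> * (real n / real N) ^ N / k ^ r \<le> real (card (copies N n t c g {}))"
          using k by (simp add: pos_divide_le_eq mult.commute)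
        moreover have "\<gamma>' * real n ^ N = \<gamma> * (real n / real N) ^ N / k ^ r"
          by (simp add: \<gamma>'_def power_divide)
        ultimately show ?thesis by (simp only:)
      qed
      have "real (card (links \<Sigma> N n t)) \<le> real (K * (n ^ N * card \<Sigma> ^ (N * n)))"
        using card_links(2)[OF finite_\<Sigma> \<open>\<Sigma> \<noteq> {}\<close>, of N n t] unfolding K_def r_def by (intro of_nat_mono)
      then have "real (card (links \<Sigma> N n t)) \<le> a powr (\<delta> * real n ^ 2)"
        using n\<^sub>0[of n] n by simp
      moreover have "\<exists>(B, \<sigma>)\<in>links \<Sigma> N n t. B \<subseteq> edges n \<and> (\<forall>x\<in>B. \<sigma> \<in> t x) \<and>
          \<delta> * real n ^ 2 \<le> real (card B) \<and> real (card {x \<in> B. c x = \<sigma>}) \<le> \<eta> * real (card B)"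
        if c: "c \<in> Q n" for c
      proof -
        have "c \<in> edges n \<rightarrow>\<^sub>E \<Sigma>" using c colourings by blast
        then obtain B \<sigma> where "(B, \<sigma>) \<in> links \<Sigma> N n t" "B \<subseteq> edges n" "\<forall>x\<in>B. \<sigma> \<in> t x"
          "(\<eta> / 2) ^ (N choose 2) * \<gamma>' / 2 * real n ^ 2 \<le> real (card B)"
          "real (card {x \<in> B. c x = \<sigma>}) \<le> \<eta> * real (card B)"
          by (rule sparse_link_in_links[OF g(1) _ many \<gamma>' n_pos \<eta>(1) _ no_full_copy[OF c g]])
            (use \<eta> in auto)
        then show ?thesis unfolding \<delta>_def r_def by blast
      qed
      ultimately show "\<exists>F. finite F \<and> real (card F) \<le> a powr (\<delta> * real n ^ 2) \<and>
        (\<forall>c \<in> Q n \<inter> realisations n t. \<exists>(B, \<sigma>)\<in>F. B \<subseteq> edges n \<and> (\<forall>x\<in>B. \<sigma> \<in> t x) \<and>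
          \<delta> * real n ^ 2 \<le> real (card B) \<and> real (card {x \<in> B. c x = \<sigma>}) \<le> \<eta> * real (card B))"
        using card_links(1)[OF finite_\<Sigma> \<open>\<Sigma> \<noteq> {}\<close>, of N n t] by blast
    qed (use full in auto)
    then obtain T where T: "T \<subseteq> templates \<Sigma> n" "\<forall>c \<in> Q n \<inter> realisations n full. \<exists>t'\<in>T. c \<in> realisations n t'"
      "\<forall>t'\<in>T. good t'" "real (card T) \<le> a powr (4 * real (mass n full))" by blast
    have "real (mass n full) = real (n choose 2) * k"
      by (simp add: mass_def full_def card_edges k_def)
    then have "a powr (4 * real (mass n full)) = k powr (\<epsilon> * real (n choose 2))"
      using k by (simp add: a_def powr_powr)
    then have "real (card T) \<le> k powr (\<epsilon> * real (n choose 2))" using T(4) by simp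
    moreover have "Q n \<subseteq> (\<Union>t\<in>T. realisations n t)" using T(2) Q_full by blast
    ultimately show "\<exists>T. T \<subseteq> templates \<Sigma> n \<and> Q n \<subseteq> (\<Union>t\<in>T. realisations n t) \<and>
      (\<forall>t\<in>T. real (card (bad_sets n N t)) \<le> \<gamma> * real (n choose N)) \<and>
      real (card T) \<le> real (card \<Sigma>) powr (\<epsilon> * real (n choose 2))"
      using T(1,3) unfolding good_def k_def by blast
  qed
qed

text \<open>One size \<open>N\<close> serves both claims. Its extremal density is near the limit, so
  few bad \<open>N\<close>-sets bound the entropy by supersaturation; and \<open>m \<le> N\<close>,
  so bad \<open>m\<close>-sets are no denser than bad \<open>N\<close>-sets.\<close>

lemma container_theorem:
  fixes \<epsilon> :: real and m :: nat
  assumes \<epsilon>: "0 < \<epsilon>"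
  shows "\<exists>n\<^sub>0. \<forall>n\<ge>n\<^sub>0. \<exists>T. T \<subseteq> templates \<Sigma> n \<and> Q n \<subseteq> (\<Union>t\<in>T. realisations n t) \<and>
    (\<forall>t\<in>T. Ent \<Sigma> n t \<le> (entropy_density \<Sigma> Q + \<epsilon>) * real (n choose 2)) \<and>
    (\<forall>t\<in>T. real (card (bad_sets n m t)) * real (card \<Sigma>) ^ (m choose 2) \<le> \<epsilon> * real (n choose m)) \<and>
    real (card T) \<le> real (card \<Sigma>) powr (\<epsilon> * real (n choose 2))"
proof -
  let ?f = "\<lambda>n. extremal \<Sigma> Q n / real (n choose 2)"
  define s where "s = real (card \<Sigma>) ^ (m choose 2)"
  have s: "0 < s" using card_\<Sigma> by (simp add: s_def)
  \<comment> \<open>The other half of \<open>\<epsilon>\<close> is left for the gap between the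
    extremal density at \<open>N\<close> and its limit; \<open>\<epsilon> / s\<close> pays for the
    passage from bad sets to bad pairs.\<close>
  define \<gamma> where "\<gamma> = min (\<epsilon> / 2) (\<epsilon> / s)"
  have \<gamma>: "0 < \<gamma>" using \<epsilon> s by (simp add: \<gamma>_def)
  have \<gamma>_le: "\<gamma> \<le> \<epsilon> / 2" "\<gamma> \<le> \<epsilon> / s"
    unfolding \<gamma>_def by (rule min.cobounded1, rule min.cobounded2)
  then have \<gamma>s: "\<gamma> * s \<le> \<epsilon>" using pos_le_divide_eq[OF s] by simp
  have "eventually (\<lambda>N. ?f N < entropy_density \<Sigma> Q + \<epsilon> / 2) sequentially"
    using entropy_density_limit(1) \<epsilon> by (intro order_tendstoD(2)) auto
  then obtain N\<^sub>0 where N\<^sub>0: "\<And>N. N \<ge> N\<^sub>0 \<Longrightarrow> ?f N < entropy_density \<Sigma> Q + \<epsilon> / 2"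
    by (auto simp: eventually_sequentially)
  define N where "N = max N\<^sub>0 (max 2 m)"
  have N: "N\<^sub>0 \<le> N" "2 \<le> N" "m \<le> N" "1 \<le> N" by (auto simp: N_def)
  obtain n\<^sub>0 where n\<^sub>0: "\<And>n. n \<ge> n\<^sub>0 \<Longrightarrow> \<exists>T. T \<subseteq> templates \<Sigma> n \<and> Q n \<subseteq> (\<Union>t\<in>T. realisations n t) \<and>
      (\<forall>t\<in>T. real (card (bad_sets n N t)) \<le> \<gamma> * real (n choose N)) \<and>
      real (card T) \<le> real (card \<Sigma>) powr (\<epsilon> * real (n choose 2))"
    using containers_with_few_bad_sets[OF N(4) \<gamma> \<epsilon>] by blast
  show ?thesis
  proof (intro exI[of _ "max N n\<^sub>0"] allI impI)
    fix n assume n: "max N n\<^sub>0 \<le> n"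
    then have nN: "N \<le> n" by simp
    obtain T where T: "T \<subseteq> templates \<Sigma> n" "Q n \<subseteq> (\<Union>t\<in>T. realisations n t)"
      and few: "\<And>t. t \<in> T \<Longrightarrow> real (card (bad_sets n N t)) \<le> \<gamma> * real (n choose N)"
      and card_T: "real (card T) \<le> real (card \<Sigma>) powr (\<epsilon> * real (n choose 2))"
      using n\<^sub>0[of n] n by auto
    have pos: "0 < real (n choose N)" using nN by (simp add: zero_less_binomial)
    have "Ent \<Sigma> n t \<le> (entropy_density \<Sigma> Q + \<epsilon>) * real (n choose 2)" if t: "t \<in> T" for t
    proof -
      have "real (card (bad_sets n N t)) / real (n choose N) \<le> \<gamma>"
        using few[OF t] pos by (simp add: pos_divide_le_eq)
      then have "?f N + real (card (bad_sets n N t)) / real (n choose N) \<le> entropy_density \<Sigma> Q + \<epsilon>"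
        using N\<^sub>0[OF N(1)] \<gamma>_le(1) by linarith
      then have "(?f N + real (card (bad_sets n N t)) / real (n choose N)) * real (n choose 2) \<le>
          (entropy_density \<Sigma> Q + \<epsilon>) * real (n choose 2)"
        by (intro mult_right_mono) auto
      then show ?thesis using Ent_supersaturation[OF N(2) nN] t T(1) by fastforce
    qed
    moreover have "real (card (bad_sets n m t)) * s \<le> \<epsilon> * real (n choose m)" if t: "t \<in> T" for t
    proof -
      have "real (card (bad_sets n m t)) * real (n choose N) \<le> real (card (bad_sets n N t)) * real (n choose m)"
        using of_nat_mono[OF card_bad_sets_mono[OF N(3) nN, of t], where 'a = real] by simp
      also have "\<dots> \<le> \<gamma> * real (n choose N) * real (n choose m)"
        using few[OF t] by (intro mult_right_mono) auto
      finally have "real (card (bad_sets n m t)) * real (n choose N) \<le>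
          (\<gamma> * real (n choose m)) * real (n choose N)"
        by (simp only: ac_simps)
      then have "real (card (bad_sets n m t)) \<le> \<gamma> * real (n choose m)"
        using pos by (rule mult_right_le_imp_le)
      then have "real (card (bad_sets n m t)) * s \<le> \<gamma> * real (n choose m) * s"
        using s by (intro mult_right_mono) auto
      also have "\<dots> = (\<gamma> * s) * real (n choose m)" by simp
      also have "\<dots> \<le> \<epsilon> * real (n choose m)" using \<gamma>s by (intro mult_right_mono) auto
      finally show ?thesis .
    qed
    ultimately show "\<exists>T. T \<subseteq> templates \<Sigma> n \<and> Q n \<subseteq> (\<Union>t\<in>T. realisations n t) \<and>
      (\<forall>t\<in>T. Ent \<Sigma> n t \<le> (entropy_density \<Sigma> Q + \<epsilon>) * real (n choose 2)) \<and>
      (\<forall>t\<in>T. real (card (bad_sets n m t)) * real (card \<Sigma>) ^ (m choose 2) \<le> \<epsilon> * real (n choose m)) \<and>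
      real (card T) \<le> real (card \<Sigma>) powr (\<epsilon> * real (n choose 2))"
      using T card_T unfolding s_def by blast
  qed
qed

section \<open>From containers to restrictions of colourings and to stability\<close>

lemma card_bad_restrictions:
  fixes \<epsilon> :: real
  assumes c: "c \<in> realisations n t"
    and few: "real (card (bad_sets n m t)) * real (card \<Sigma>) ^ (m choose 2) \<le> \<epsilon> * real (n choose m)"
  shows "real (card {A \<in> nsets {1..n} m. restr c A \<notin> Q m}) \<le> \<epsilon> * real (n choose m)"
proof -
  have "card {A \<in> nsets {1..n} m. restr c A \<notin> Q m} \<le> card (bad_sets n m t)"
    using c by (intro card_mono) (auto simp: bad_sets_def finite_imp_finite_nsets)
  then have "real (card {A \<in> nsets {1..n} m. restr c A \<notin> Q m}) \<le> real (card (bad_sets n m t)) * 1" by simp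
  also have "\<dots> \<le> real (card (bad_sets n m t)) * real (card \<Sigma>) ^ (m choose 2)"
    using card_\<Sigma> by (intro mult_left_mono one_le_power) auto
  finally show ?thesis using few by linarith
qed

text \<open>Keeping \<open>c\<close> where \<open>t\<close> and \<open>s n\<close> agree and taking
  any colour allowed by \<open>s n\<close> elsewhere gives a realisation of \<open>s n\<close> that
  differs from \<open>c\<close> only where the templates differ.\<close>

lemma dist_family_le:
  assumes s: "s \<in> S" "s n \<in> templates \<Sigma> n" and c: "c \<in> realisations n t"
  shows "dist_family n c S \<le> edit_dist n t (s n)"
proof -
  let ?M = "{edit_dist n c c' | c' t. t \<in> S \<and> c' \<in> realisations n (t n)}"
  \<comment> \<open>\<open>S\<close> may be infinite, but the distances are bounded by the number of
    edges, so the minimum is over a finite set.\<close>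
  have "?M \<subseteq> {..card (edges n)}"
    by (auto simp: edit_dist_def intro: card_mono)
  then have fin: "finite ?M" by (rule finite_subset) simp
  define c' where "c' = restrict (\<lambda>e. if t e = s n e then c e else (SOME x. x \<in> s n e)) (edges n)"
  have "c' \<in> realisations n (s n)"
    unfolding realisations_def
  proof (rule PiE_I)
    fix e assume e: "e \<in> edges n"
    have "c e \<in> t e" using c e unfolding realisations_def by (rule PiE_mem)
    moreover have "(SOME x. x \<in> s n e) \<in> s n e"
      using template_edge(2)[OF s(2) e] by (simp add: some_in_eq)
    ultimately show "c' e \<in> s n e" using e by (cases "t e = s n e") (simp_all add: c'_def)
  qed (simp add: c'_def)
  then have "dist_family n c S \<le> edit_dist n c c'"
    unfolding dist_family_def using s(1) by (intro Min_le[OF fin]) blast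
  also have "\<dots> \<le> edit_dist n t (s n)"
    unfolding edit_dist_def by (intro card_mono) (auto simp: c'_def)
  finally show ?thesis .
qed

text \<open>With \<open>C\<close> for \<open>n choose 2\<close> and \<open>d\<close> for the entropy
  density, the far colourings lie in at most \<open>k powr (\<delta> / 2 * C)\<close> containers of
  entropy at most \<open>(d - \<delta>) * C\<close>. Their number is thus smaller by a factor
  \<open>k powr (- (\<delta> / 2) * C)\<close> than the lower bound \<open>k powr (d * C)\<close>
  for \<open>card (Q n)\<close>.\<close>

lemma stability:
  fixes \<epsilon> :: real
  assumes S: "strong_stability_family \<Sigma> Q S" and \<epsilon>: "0 < \<epsilon>"
  shows "\<exists>n\<^sub>0. \<forall>n\<ge>n\<^sub>0. real (card {c \<in> Q n. real (dist_family n c S) > \<epsilon> * real (n choose 2)})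
    \<le> \<epsilon> * real (card (Q n))"
proof -
  define k where "k = real (card \<Sigma>)"
  have k: "1 < k" using card_\<Sigma> by (simp add: k_def)
  obtain \<delta> m n\<^sub>1 where \<delta>: "\<delta> > 0"
    and close: "\<And>n t. n \<ge> n\<^sub>1 \<Longrightarrow> t \<in> templates \<Sigma> n \<Longrightarrow>
        Ent \<Sigma> n t \<ge> (entropy_density \<Sigma> Q - \<delta>) * real (n choose 2) \<Longrightarrow>
        real (card {(A, c). A \<in> nsets {1..n} m \<and> c \<in> realisations m (restr t A) \<and> c \<notin> Q m})
          \<le> \<delta> * real (n choose m) \<Longrightarrow> \<exists>s\<in>S. real (edit_dist n t (s n)) \<le> \<epsilon> * real (n choose 2)"
    using S \<epsilon> unfolding strong_stability_family_def by meson
  have seqs: "S \<subseteq> template_seqs \<Sigma>" using S by (simp add: strong_stability_family_def)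
  obtain n\<^sub>2 where n\<^sub>2: "\<And>n. n \<ge> n\<^sub>2 \<Longrightarrow> \<exists>T. T \<subseteq> templates \<Sigma> n \<and> Q n \<subseteq> (\<Union>t\<in>T. realisations n t) \<and>
      (\<forall>t\<in>T. Ent \<Sigma> n t \<le> (entropy_density \<Sigma> Q + \<delta> / 2) * real (n choose 2)) \<and>
      (\<forall>t\<in>T. real (card (bad_sets n m t)) * real (card \<Sigma>) ^ (m choose 2) \<le> \<delta> / 2 * real (n choose m)) \<and>
      real (card T) \<le> real (card \<Sigma>) powr (\<delta> / 2 * real (n choose 2))"
    using container_theorem[of "\<delta> / 2" m] \<delta> by auto
  \<comment> \<open>Chosen for \<open>k powr (- (\<delta> / 2) * C) \<le> \<epsilon>\<close>, given
    that \<open>n \<le> 2 * C\<close> for \<open>n \<ge> 3\<close>.\<close>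
  obtain n\<^sub>3 :: nat where n\<^sub>3: "- log k \<epsilon> * 4 / \<delta> \<le> real n\<^sub>3" using real_arch_simple by blast
  show ?thesis
  proof (intro exI[of _ "max (max n\<^sub>1 n\<^sub>2) (max 3 n\<^sub>3)"] allI impI)
    fix n assume n: "max (max n\<^sub>1 n\<^sub>2) (max 3 n\<^sub>3) \<le> n"
    define C where "C = real (n choose 2)"
    define d where "d = entropy_density \<Sigma> Q"
    let ?far = "{c \<in> Q n. real (dist_family n c S) > \<epsilon> * real (n choose 2)}"
    obtain T where T: "T \<subseteq> templates \<Sigma> n" "Q n \<subseteq> (\<Union>t\<in>T. realisations n t)"
      and few: "\<And>t. t \<in> T \<Longrightarrow> real (card (bad_sets n m t)) * real (card \<Sigma>) ^ (m choose 2) \<le> \<delta> / 2 * real (n choose m)"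
      and card_T: "real (card T) \<le> k powr (\<delta> / 2 * C)"
      using n\<^sub>2[of n] n unfolding k_def C_def by auto
    have finT: "finite T" using T(1) finite_templates[OF finite_\<Sigma>] by (rule finite_subset)
    define T' where "T' = {t \<in> T. Ent \<Sigma> n t \<le> (d - \<delta>) * C}"
    \<comment> \<open>A container of larger entropy has few bad pairs, so it is close to some
      \<open>s n\<close> with \<open>s \<in> S\<close>, and so are all its realisations.\<close>
    have "?far \<subseteq> (\<Union>t\<in>T'. realisations n t)"
    proof
      fix c assume c: "c \<in> ?far"
      then obtain t where t: "t \<in> T" "c \<in> realisations n t" using T(2) by blast
      have tt: "t \<in> templates \<Sigma> n" using t(1) T(1) by blast
      have "Ent \<Sigma> n t < (d - \<delta>) * C"
      proof (rule ccontr)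
        assume "\<not> Ent \<Sigma> n t < (d - \<delta>) * C"
        then have "Ent \<Sigma> n t \<ge> (entropy_density \<Sigma> Q - \<delta>) * real (n choose 2)" by (simp add: d_def C_def)
        moreover have "real (card {(A, c). A \<in> nsets {1..n} m \<and> c \<in> realisations m (restr t A) \<and> c \<notin> Q m})
          \<le> \<delta> * real (n choose m)"
        proof -
          have "real (card {(A, c). A \<in> nsets {1..n} m \<and> c \<in> realisations m (restr t A) \<and> c \<notin> Q m})
            \<le> real (card (bad_sets n m t) * card \<Sigma> ^ (m choose 2))"
            by (intro of_nat_mono card_bad_pairs[OF tt])
          also have "\<dots> \<le> \<delta> / 2 * real (n choose m)" using few[OF t(1)] by simp
          also have "\<dots> \<le> \<delta> * real (n choose m)" using \<delta> by (intro mult_right_mono) auto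
          finally show ?thesis .
        qed
        ultimately obtain s where s: "s \<in> S" "real (edit_dist n t (s n)) \<le> \<epsilon> * real (n choose 2)"
          using close[of n t] tt n by auto
        have "s n \<in> templates \<Sigma> n" using s(1) seqs by (auto simp: template_seqs_def)
        from of_nat_mono[OF dist_family_le[OF s(1) this t(2)], where 'a = real] s(2) c
        show False by simp
      qed
      then show "c \<in> (\<Union>t\<in>T'. realisations n t)" using t by (auto simp: T'_def)
    qed
    moreover have "finite (\<Union>t\<in>T'. realisations n t)"
      using finT T(1) finite_realisations[OF finite_\<Sigma>] by (auto simp: T'_def)
    ultimately have "card ?far \<le> card (\<Union>t\<in>T'. realisations n t)" by (rule card_mono[rotated])
    also have "\<dots> \<le> (\<Sum>t\<in>T'. card (realisations n t))"
      using finT by (intro card_UN_le) (simp add: T'_def)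
    finally have "real (card ?far) \<le> (\<Sum>t\<in>T'. real (card (realisations n t)))"
      by (simp only: of_nat_le_iff flip: of_nat_sum)
    also have "\<dots> \<le> (\<Sum>t\<in>T'. k powr ((d - \<delta>) * C))"
    proof (rule sum_mono)
      fix t assume t: "t \<in> T'"
      then have "real (card (realisations n t)) = k powr Ent \<Sigma> n t"
        using card_realisations T(1) by (auto simp: T'_def k_def)
      also have "\<dots> \<le> k powr ((d - \<delta>) * C)"
        using t k by (intro powr_mono) (auto simp: T'_def)
      finally show "real (card (realisations n t)) \<le> k powr ((d - \<delta>) * C)" .
    qed
    also have "\<dots> = real (card T') * k powr ((d - \<delta>) * C)" by simp
    also have "\<dots> \<le> k powr (\<delta> / 2 * C) * k powr ((d - \<delta>) * C)"
    proof (rule mult_right_mono)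
      have "card T' \<le> card T" using finT by (intro card_mono) (auto simp: T'_def)
      then show "real (card T') \<le> k powr (\<delta> / 2 * C)" using card_T by linarith
    qed simp
    also have "\<dots> = k powr (- (\<delta> / 2) * C) * k powr (d * C)"
      by (simp add: algebra_simps flip: powr_add)
    also have "\<dots> \<le> \<epsilon> * real (card (Q n))"
    proof (rule mult_mono)
      have "real n \<le> 2 * C"
      proof -
        have "n * 2 \<le> n * (n - 1)" using n by (intro mult_le_mono2) linarith
        also have "\<dots> = 2 * (n choose 2)"
          unfolding choose_two by (cases "even n") auto
        finally show ?thesis unfolding C_def by linarith
      qed
      then have "- log k \<epsilon> * 4 / \<delta> \<le> 2 * C" using n\<^sub>3 n by linarith
      then have "- (\<delta> / 2) * C \<le> log k \<epsilon>" using \<delta> by (simp add: field_simps)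
      then have "k powr (- (\<delta> / 2) * C) \<le> k powr log k \<epsilon>" using k by (intro powr_mono) auto
      then show "k powr (- (\<delta> / 2) * C) \<le> \<epsilon>" using k \<epsilon> by simp
      show "k powr (d * C) \<le> real (card (Q n))"
        using card_property_ge[of n] n by (simp add: k_def d_def C_def)
    qed (use \<epsilon> in auto)
    finally show "real (card ?far) \<le> \<epsilon> * real (card (Q n))" .
  qed
qed

end

section \<open>Digraphs as colourings\<close>

lemma finite_palette: "finite (palette \<kappa>)"
  by (cases \<kappa>) auto

lemma card_palette: "card (palette \<kappa>) = (case \<kappa> of Digraphs \<Rightarrow> 4 | Orgraphs \<Rightarrow> 3 | Tournaments \<Rightarrow> 2)"
  by (cases \<kappa>) auto

lemma edge_Min_Max:
  assumes "e \<in> edges n"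
  shows "Min e \<in> {1..n}" "Max e \<in> {1..n}" "Min e < Max e" "e = {Min e, Max e}"
proof -
  obtain a b where e: "e = {a, b}" "a < b" "a \<in> {1..n}" "b \<in> {1..n}"
    using assms unfolding edges_def ordered_nsets_2_eq by blast
  then show "Min e \<in> {1..n}" "Max e \<in> {1..n}" "Min e < Max e" "e = {Min e, Max e}" by auto
qed

text \<open>Asymmetry excludes colour 4 and totality excludes colour 1.\<close>

lemma pair_colour_palette:
  assumes D: "of_kind \<kappa> n D" and ij: "i \<in> {1..n}" "j \<in> {1..n}" "i \<noteq> j"
  shows "pair_colour D i j \<in> palette \<kappa>"
proof (cases \<kappa>)
  case Orgraphs
  then have "asym D" using D by (simp add: orgraph_on_def)
  then show ?thesis using Orgraphs by (auto simp: pair_colour_def dest: asymD)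
next
  case Tournaments
  then have "asym D" "total_on {1..n} D" using D by (simp_all add: tournament_on_def orgraph_on_def)
  moreover from this(2) have tot: "(i, j) \<in> D \<or> (j, i) \<in> D"
    using ij unfolding total_on_def by blast
  ultimately show ?thesis
    using Tournaments tot by (auto simp: pair_colour_def dest: asymD)
qed (auto simp: pair_colour_def)

lemma encode_colouring:
  assumes "of_kind \<kappa> n D"
  shows "encode n D \<in> edges n \<rightarrow>\<^sub>E palette \<kappa>"
  unfolding encode_def
proof (rule restrict_PiE_iff[THEN iffD2], rule ballI)
  fix e assume "e \<in> edges n"
  from edge_Min_Max[OF this] show "pair_colour D (Min e) (Max e) \<in> palette \<kappa>"
    by (intro pair_colour_palette[OF assms]) auto
qed

text \<open>The enumeration of \<open>A\<close> keeps the smaller end of an edge smaller, so the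
  directions coded by 2 and 3 are preserved.\<close>

lemma restr_encode:
  assumes A: "A \<subseteq> {1..n}"
  shows "restr (encode n D) A = encode (card A) (induced_subgraph D A)"
  unfolding restr_def encode_def[of "card A"]
proof (rule restrict_ext)
  fix e assume e: "e \<in> edges (card A)"
  have fin: "finite A" using A finite_subset by blast
  define i j where "i = Min e" and "j = Max e"
  have ij: "i \<in> {1..card A}" "j \<in> {1..card A}" "i < j" "e = {i, j}"
    using edge_Min_Max[OF e] unfolding i_def j_def by blast+
  have less: "elt A i < elt A j"
    using strict_mono_onD[OF strict_mono_on_elt[OF fin] ij(1,2,3)] .
  have im: "elt A ` e = {elt A i, elt A j}" using ij(4) by simp
  have "encode n D (elt A ` e) = pair_colour D (elt A i) (elt A j)"
    using elt_edge(1)[OF A e] less unfolding im by (simp add: encode_def)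
  also have "\<dots> = pair_colour (induced_subgraph D A) i j"
    using ij by (simp add: pair_colour_def induced_subgraph_def)
  finally show "encode n D (elt A ` e) = pair_colour (induced_subgraph D A) (Min e) (Max e)"
    by (simp add: i_def j_def)
qed

lemma order_hereditary_colouring_property:
  assumes her: "hereditary \<kappa> P" and ne: "\<And>n. P n \<noteq> {}"
  shows "order_hereditary (palette \<kappa>) (colouring_property P)"
proof
  show "finite (palette \<kappa>)" by (rule finite_palette)
  show "2 \<le> card (palette \<kappa>)" by (cases \<kappa>) auto
  fix n
  show "colouring_property P n \<subseteq> edges n \<rightarrow>\<^sub>E palette \<kappa>"
    using her encode_colouring unfolding hereditary_def colouring_property_def by blast
  show "colouring_property P n \<noteq> {}" using ne by (simp add: colouring_property_def)
  fix c A assume "c \<in> colouring_property P n" and A: "A \<subseteq> {1..n}"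
  then obtain D where D: "D \<in> P n" "c = encode n D" by (auto simp: colouring_property_def)
  have "induced_subgraph D A \<in> P (card A)"
    using her D(1) A unfolding hereditary_def by blast
  then show "restr c A \<in> colouring_property P (card A)"
    unfolding D(2) restr_encode[OF A] colouring_property_def by (rule imageI)
qed

theorem corollary3p4:
  fixes \<kappa> :: digraph_kind
    and P :: "nat \<Rightarrow> nat rel set"
    and \<Sigma> :: "nat set"
    and k :: nat
    and Q :: "nat \<Rightarrow> colouring set"
  assumes "hereditary \<kappa> P"
    and "\<And>n. P n \<noteq> {}"
    and "\<Sigma> = palette \<kappa>"
    and "k = (case \<kappa> of Digraphs \<Rightarrow> 4 | Orgraphs \<Rightarrow> 3 | Tournaments \<Rightarrow> 2)"
    and "Q = colouring_property P"
  shows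
    "(\<forall>\<epsilon>::real. \<epsilon> > 0 \<longrightarrow> (\<forall>m::nat. \<exists>n\<^sub>0::nat. \<forall>n\<ge>n\<^sub>0. \<exists>T. T \<subseteq> templates \<Sigma> n \<and>
        Q n \<subseteq> (\<Union>t\<in>T. realisations n t) \<and>
        (\<forall>t\<in>T. Ent \<Sigma> n t \<le> (entropy_density \<Sigma> Q + \<epsilon>) * real (n choose 2)) \<and>
        (\<forall>t\<in>T. \<forall>c\<in>realisations n t.
           real (card {A \<in> nsets {1..n} m. restr c A \<notin> Q m}) \<le> \<epsilon> * real (n choose m)) \<and>
        real (card T) \<le> real k powr (\<epsilon> * real (n choose 2))))
     \<and>
     (\<forall>S. strong_stability_family \<Sigma> Q S \<longrightarrow>
        (\<forall>\<epsilon>::real. \<epsilon> > 0 \<longrightarrow> (\<exists>n\<^sub>0::nat. \<forall>n\<ge>n\<^sub>0.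
          real (card {c \<in> Q n. real (dist_family n c S) > \<epsilon> * real (n choose 2)})
            \<le> \<epsilon> * real (card (Q n)))))"
proof -
  interpret order_hereditary \<Sigma> Q
    unfolding assms(3,5) by (rule order_hereditary_colouring_property[OF assms(1,2)])
  have k: "k = card \<Sigma>" using assms(3,4) card_palette by simp
  show ?thesis
  proof (intro conjI allI impI)
    fix \<epsilon> :: real and m assume "\<epsilon> > 0"
    then obtain n\<^sub>0 where n\<^sub>0: "\<And>n. n\<^sub>0 \<le> n \<Longrightarrow> \<exists>T. T \<subseteq> templates \<Sigma> n \<and>
        Q n \<subseteq> (\<Union>t\<in>T. realisations n t) \<and>
        (\<forall>t\<in>T. Ent \<Sigma> n t \<le> (entropy_density \<Sigma> Q + \<epsilon>) * real (n choose 2)) \<and>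
        (\<forall>t\<in>T. real (card (bad_sets n m t)) * real (card \<Sigma>) ^ (m choose 2) \<le> \<epsilon> * real (n choose m)) \<and>
        real (card T) \<le> real (card \<Sigma>) powr (\<epsilon> * real (n choose 2))"
      using container_theorem by blast
    show "\<exists>n\<^sub>0. \<forall>n\<ge>n\<^sub>0. \<exists>T. T \<subseteq> templates \<Sigma> n \<and>
        Q n \<subseteq> (\<Union>t\<in>T. realisations n t) \<and>
        (\<forall>t\<in>T. Ent \<Sigma> n t \<le> (entropy_density \<Sigma> Q + \<epsilon>) * real (n choose 2)) \<and>
        (\<forall>t\<in>T. \<forall>c\<in>realisations n t.
           real (card {A \<in> nsets {1..n} m. restr c A \<notin> Q m}) \<le> \<epsilon> * real (n choose m)) \<and>
        real (card T) \<le> real k powr (\<epsilon> * real (n choose 2))"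
    proof (intro exI[of _ n\<^sub>0] allI impI, drule n\<^sub>0, elim exE conjE, intro exI conjI ballI)
      fix n T t c
      assume "\<forall>t\<in>T. real (card (bad_sets n m t)) * real (card \<Sigma>) ^ (m choose 2) \<le> \<epsilon> * real (n choose m)"
        and "t \<in> T" "c \<in> realisations n t"
      then show "real (card {A \<in> nsets {1..n} m. restr c A \<notin> Q m}) \<le> \<epsilon> * real (n choose m)"
        using card_bad_restrictions by blast
    qed (simp_all add: k)
  qed (rule stability)
qed

end
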